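(* Let $S$ be a (possibly infinite) unital Boolean algebra, viewed as an inverse semigroup by $ab=a\wedge b$, and let $B(S)$ be the associated Boolean (Stone) space. Then there are isomorphisms of abelian groups $$K(S)\cong Z(B(S))\quad\text{and}\quad K(S)\cong K^{0}_{\mathbb{C}}(B(S)),$$ where $Z(B(S))$ is the group of continuous functions $B(S)\to\mathbb{Z}$ (with $\mathbb{Z}$ discrete) under pointwise addition and $K^{0}_{\mathbb{C}}(B(S))$ is the complex topological $K^0$-group of $B(S)$.
   Context: $B(S)$ is the space of ultrafilters of $S$ with basis the sets $\mathcal{V}_a$ of ultrafilters containing $a$, $a\in S$. $K^0_{\mathbb{C}}(X)$ is the Grothendieck group of the commutative monoid of isomorphism classes of locally trivial finite-dimensional complex vector bundles over the compact Hausdorff space $X$ under Whitney sum (rank need only be locally constant). $K$-group of an orthogonally complete inverse semigroup $S$ (one with zero in which every pair of orthogonal elements, i.e. $s^{-1}t=0=st^{-1}$, has a join for the natural partial order, and multiplication distributes over finite orthogonal joins): $M_\omega(S)$ is the set of $\mathbb{N}\times\mathbb{N}$ matrices over $S$ with only finitely many non-zero entries such that $a^{-1}b=0$ for entries in distinct positions of the same row and $ab^{-1}=0$ for entries in distinct positions of the same column, with product $(AB)_{ij}=\bigvee_k a_{ik}b_{kj}$; it is an orthogonally complete inverse semigroup. Idempotents satisfy $E\,\mathcal{D}\,F$ iff there is $A$ with $A^{-1}A=E$, $AA^{-1}=F$. $A(M_\omega(S))$ is the set of $\mathcal{D}$-classes of idempotents of $M_\omega(S)$, a commutative monoid under $[E]+[F]=[E'\vee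 F']$ where $E'\,\mathcal{D}\,E$, $F'\,\mathcal{D}\,F$, $E'\perp F'$; $K(S)$ is its Grothendieck group. *)

theory Defs
  imports "HOL-Analysis.Analysis" "HOL-Algebra.Group"
begin

section \<open>Inverse semigroups\<close>

record 'a semigrp = "'a partial_object" +
  smult :: "'a \<Rightarrow> 'a \<Rightarrow> 'a" (infixl \<open>\<star>\<index>\<close> 70)

definition is_sinverse :: "('a, 'm) semigrp_scheme \<Rightarrow> 'a \<Rightarrow> 'a \<Rightarrow> bool" where
  "is_sinverse S a b \<longleftrightarrow> b \<in> carrier S \<and> a \<star>\<^bsub>S\<^esub> b \<star>\<^bsub>S\<^esub> a = a \<and> b \<star>\<^bsub>S\<^esub> a \<star>\<^bsub>S\<^esub> b = b"

definition inverse_semigroup :: "('a, 'm) semigrp_scheme \<Rightarrow> bool" where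
  "inverse_semigroup S \<longleftrightarrow>
     (\<forall>a\<in>carrier S. \<forall>b\<in>carrier S. a \<star>\<^bsub>S\<^esub> b \<in> carrier S) \<and>
     (\<forall>a\<in>carrier S. \<forall>b\<in>carrier S. \<forall>c\<in>carrier S.
        a \<star>\<^bsub>S\<^esub> b \<star>\<^bsub>S\<^esub> c = a \<star>\<^bsub>S\<^esub> (b \<star>\<^bsub>S\<^esub> c)) \<and>
     (\<forall>a\<in>carrier S. \<exists>!b. is_sinverse S a b)"

definition sinv :: "('a, 'm) semigrp_scheme \<Rightarrow> 'a \<Rightarrow> 'a" where
  "sinv S a = (THE b. is_sinverse S a b)"

definition is_szero :: "('a, 'm) semigrp_scheme \<Rightarrow> 'a \<Rightarrow> bool" where
  "is_szero S z \<longleftrightarrow> z \<in> carrier S \<and> (\<forall>a\<in>carrier S. z \<star>\<^bsub>S\<^esub> a = z \<and> a \<star>\<^bsub>S\<^esub> z = z)"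

definition szero :: "('a, 'm) semigrp_scheme \<Rightarrow> 'a" where
  "szero S = (THE z. is_szero S z)"

definition idempotents :: "('a, 'm) semigrp_scheme \<Rightarrow> 'a set" where
  "idempotents S = {e \<in> carrier S. e \<star>\<^bsub>S\<^esub> e = e}"

definition sle :: "('a, 'm) semigrp_scheme \<Rightarrow> 'a \<Rightarrow> 'a \<Rightarrow> bool" where
  "sle S a b \<longleftrightarrow> (\<exists>e\<in>idempotents S. a = b \<star>\<^bsub>S\<^esub> e)"

definition orthogonal_elts :: "('a, 'm) semigrp_scheme \<Rightarrow> 'a \<Rightarrow> 'a \<Rightarrow> bool" where
  "orthogonal_elts S a b \<longleftrightarrow> sinv S a \<star>\<^bsub>S\<^esub> b = szero S \<and> a \<star>\<^bsub>S\<^esub> sinv S b = szero S"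

definition is_sjoin :: "('a, 'm) semigrp_scheme \<Rightarrow> 'a set \<Rightarrow> 'a \<Rightarrow> bool" where
  "is_sjoin S X j \<longleftrightarrow> j \<in> carrier S \<and> (\<forall>x\<in>X. sle S x j) \<and>
     (\<forall>k\<in>carrier S. (\<forall>x\<in>X. sle S x k) \<longrightarrow> sle S j k)"

definition sjoin :: "('a, 'm) semigrp_scheme \<Rightarrow> 'a set \<Rightarrow> 'a" where
  "sjoin S X = (THE j. is_sjoin S X j)"

definition orthogonally_complete :: "('a, 'm) semigrp_scheme \<Rightarrow> bool" where
  "orthogonally_complete S \<longleftrightarrow> inverse_semigroup S \<and> (\<exists>z. is_szero S z) \<and>
     (\<forall>a\<in>carrier S. \<forall>b\<in>carrier S. orthogonal_elts S a b \<longrightarrow>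
        (\<exists>j. is_sjoin S {a, b} j \<and>
          (\<forall>c\<in>carrier S. is_sjoin S {c \<star>\<^bsub>S\<^esub> a, c \<star>\<^bsub>S\<^esub> b} (c \<star>\<^bsub>S\<^esub> j) \<and>
                         is_sjoin S {a \<star>\<^bsub>S\<^esub> c, b \<star>\<^bsub>S\<^esub> c} (j \<star>\<^bsub>S\<^esub> c))))"


section \<open>The $K$-group of an orthogonally complete inverse semigroup\<close>

definition rook_matrices :: "('a, 'm) semigrp_scheme \<Rightarrow> (nat \<Rightarrow> nat \<Rightarrow> 'a) semigrp" where
  "rook_matrices S = \<lparr>
     carrier = {A. (\<forall>i j. A i j \<in> carrier S) \<and>
                   finite {(i, j). A i j \<noteq> szero S} \<and>
                   (\<forall>i j k. j \<noteq> k \<longrightarrow> sinv S (A i j) \<star>\<^bsub>S\<^esub> A i k = szero S) \<and>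
                   (\<forall>i j k. i \<noteq> j \<longrightarrow> A i k \<star>\<^bsub>S\<^esub> sinv S (A j k) = szero S)},
     smult = (\<lambda>A B i j. sjoin S {A i k \<star>\<^bsub>S\<^esub> B k j | k. True})\<rparr>"

definition green_D :: "('a, 'm) semigrp_scheme \<Rightarrow> 'a \<Rightarrow> 'a \<Rightarrow> bool" where
  "green_D S e f \<longleftrightarrow> (\<exists>a\<in>carrier S. sinv S a \<star>\<^bsub>S\<^esub> a = e \<and> a \<star>\<^bsub>S\<^esub> sinv S a = f)"

definition D_class :: "('a, 'm) semigrp_scheme \<Rightarrow> 'a \<Rightarrow> 'a set" where
  "D_class S e = {f \<in> idempotents S. green_D S e f}"

text \<open>The sum is written as the union of the classes of \<open>E' \<or> F'\<close> over all orthogonal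
  representatives \<open>E'\<close>, \<open>F'\<close>; as the class does not depend on the choice, this is that
  class.\<close>

definition idempotent_class_monoid :: "('a, 'm) semigrp_scheme \<Rightarrow> 'a set monoid" where
  "idempotent_class_monoid M = \<lparr>
     carrier = D_class M ` idempotents M,
     mult = (\<lambda>P Q. \<Union>{D_class M (sjoin M {e, f}) | e f.
                        e \<in> P \<and> f \<in> Q \<and> orthogonal_elts M e f}),
     one = D_class M (szero M)\<rparr>"

text \<open>The Grothendieck group: formal differences \<open>(a, b)\<close> modulo
  \<open>(a, b) \<sim> (c, d)\<close> iff \<open>a + d + k = c + b + k\<close> for some \<open>k\<close>. As in HOL-Algebra,
  commutative monoids and groups are written multiplicatively.\<close>

definition grothendieck_rel :: "('a, 'm) monoid_scheme \<Rightarrow> (('a \<times> 'a) \<times> ('a \<times> 'a)) set" where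
  "grothendieck_rel M = {((a, b), (c, d)) | a b c d.
     a \<in> carrier M \<and> b \<in> carrier M \<and> c \<in> carrier M \<and> d \<in> carrier M \<and>
     (\<exists>k\<in>carrier M. a \<otimes>\<^bsub>M\<^esub> d \<otimes>\<^bsub>M\<^esub> k = c \<otimes>\<^bsub>M\<^esub> b \<otimes>\<^bsub>M\<^esub> k)}"

definition grothendieck_group :: "('a, 'm) monoid_scheme \<Rightarrow> ('a \<times> 'a) set monoid" where
  "grothendieck_group M = \<lparr>
     carrier = (carrier M \<times> carrier M) // grothendieck_rel M,
     mult = (\<lambda>P Q. \<Union>(a, b)\<in>P. \<Union>(c, d)\<in>Q.
                     grothendieck_rel M `` {(a \<otimes>\<^bsub>M\<^esub> c, b \<otimes>\<^bsub>M\<^esub> d)}),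
     one = grothendieck_rel M `` {(\<one>\<^bsub>M\<^esub>, \<one>\<^bsub>M\<^esub>)}\<rparr>"

definition K_group ::
  "('a, 'm) semigrp_scheme \<Rightarrow>
     ((nat \<Rightarrow> nat \<Rightarrow> 'a) set \<times> (nat \<Rightarrow> nat \<Rightarrow> 'a) set) set monoid" where
  "K_group S = grothendieck_group (idempotent_class_monoid (rook_matrices S))"


section \<open>Boolean algebras and their Stone spaces\<close>

definition boolean_semigroup :: "'a::boolean_algebra semigrp" where
  "boolean_semigroup = \<lparr>carrier = UNIV, smult = inf\<rparr>"

definition proper_filter :: "'a::boolean_algebra set \<Rightarrow> bool" where
  "proper_filter F \<longleftrightarrow> F \<noteq> {} \<and> bot \<notin> F \<and>
     (\<forall>a\<in>F. \<forall>b. a \<le> b \<longrightarrow> b \<in> F) \<and> (\<forall>a\<in>F. \<forall>b\<in>F. inf a b \<in> F)"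

definition ultrafilters :: "'a::boolean_algebra set set" where
  "ultrafilters = {F. proper_filter F \<and> (\<forall>G. proper_filter G \<and> F \<subseteq> G \<longrightarrow> G = F)}"

definition stone_basic :: "'a::boolean_algebra \<Rightarrow> 'a set set" where
  "stone_basic a = {F \<in> ultrafilters. a \<in> F}"

definition stone_space :: "'a::boolean_algebra set topology" where
  "stone_space = topology (arbitrary union_of (\<lambda>U. U \<in> range stone_basic))"

text \<open>Maps are taken to be \<open>undefined\<close> outside the space, so that equality of elements
  is equality of maps on the space.\<close>

definition continuous_int_group :: "'x topology \<Rightarrow> ('x \<Rightarrow> int) monoid" where
  "continuous_int_group X = \<lparr>
     carrier = {f \<in> extensional (topspace X). continuous_map X (discrete_topology UNIV) f},
     mult = (\<lambda>f g. \<lambda>x\<in>topspace X. f x + g x),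
     one = (\<lambda>x\<in>topspace X. 0)\<rparr>"


section \<open>Complex vector bundles and topological $K$-theory\<close>

definition complex_vector_space_on ::
  "'e set \<Rightarrow> ('e \<Rightarrow> 'e \<Rightarrow> 'e) \<Rightarrow> (complex \<Rightarrow> 'e \<Rightarrow> 'e) \<Rightarrow> bool" where
  "complex_vector_space_on V add scal \<longleftrightarrow>
     (\<exists>z. comm_group \<lparr>carrier = V, mult = add, one = z\<rparr>) \<and>
     (\<forall>c. \<forall>u\<in>V. scal c u \<in> V) \<and>
     (\<forall>c. \<forall>u\<in>V. \<forall>v\<in>V. scal c (add u v) = add (scal c u) (scal c v)) \<and>
     (\<forall>c d. \<forall>u\<in>V. scal (c + d) u = add (scal c u) (scal d u)) \<and>
     (\<forall>c d. \<forall>u\<in>V. scal c (scal d u) = scal (c * d) u) \<and>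
     (\<forall>u\<in>V. scal 1 u = u)"

text \<open>\<open>\<complex>\<^sup>n\<close>, as the sequences that vanish from position \<open>n\<close> on (compare
  \<^const>\<open>Euclidean_space\<close>).\<close>

definition complex_space :: "nat \<Rightarrow> (nat \<Rightarrow> complex) topology" where
  "complex_space n =
     subtopology (product_topology (\<lambda>_. euclidean) UNIV) {z. \<forall>i\<ge>n. z i = 0}"

text \<open>The operations \<open>badd\<close> and \<open>bscale\<close> only matter within the fibres.\<close>

record ('x, 'e) vbundle =
  tspace :: "'e topology"
  bproj :: "'e \<Rightarrow> 'x"
  badd :: "'e \<Rightarrow> 'e \<Rightarrow> 'e"
  bscale :: "complex \<Rightarrow> 'e \<Rightarrow> 'e"

definition preim :: "('x, 'e) vbundle \<Rightarrow> 'x set \<Rightarrow> 'e set" where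
  "preim B U = {e \<in> topspace (tspace B). bproj B e \<in> U}"

abbreviation fibre :: "('x, 'e) vbundle \<Rightarrow> 'x \<Rightarrow> 'e set" where
  "fibre B x \<equiv> preim B {x}"

definition local_trivialization ::
  "'x topology \<Rightarrow> ('x, 'e) vbundle \<Rightarrow> 'x set \<Rightarrow> nat \<Rightarrow> ('e \<Rightarrow> 'x \<times> (nat \<Rightarrow> complex)) \<Rightarrow> bool" where
  "local_trivialization X B U n h \<longleftrightarrow>
     openin X U \<and>
     homeomorphic_map (subtopology (tspace B) (preim B U))
       (prod_topology (subtopology X U) (complex_space n)) h \<and>
     (\<forall>e \<in> preim B U. fst (h e) = bproj B e) \<and>
     (\<forall>x\<in>U. \<forall>e \<in> fibre B x. \<forall>f \<in> fibre B x.
        snd (h (badd B e f)) = (\<lambda>i. snd (h e) i + snd (h f) i)) \<and>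
     (\<forall>x\<in>U. \<forall>c. \<forall>e \<in> fibre B x. snd (h (bscale B c e)) = (\<lambda>i. c * snd (h e) i))"

definition vector_bundle :: "'x topology \<Rightarrow> ('x, 'e) vbundle \<Rightarrow> bool" where
  "vector_bundle X B \<longleftrightarrow>
     continuous_map (tspace B) X (bproj B) \<and>
     (\<forall>x \<in> topspace X. complex_vector_space_on (fibre B x) (badd B) (bscale B)) \<and>
     (\<forall>x \<in> topspace X. \<exists>U n h. x \<in> U \<and> local_trivialization X B U n h)"

definition bundle_iso :: "('x, 'e) vbundle \<Rightarrow> ('x, 'f) vbundle \<Rightarrow> ('e \<Rightarrow> 'f) \<Rightarrow> bool" where
  "bundle_iso B C h \<longleftrightarrow>
     homeomorphic_map (tspace B) (tspace C) h \<and>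
     (\<forall>e \<in> topspace (tspace B). bproj C (h e) = bproj B e) \<and>
     (\<forall>x. \<forall>e \<in> fibre B x. \<forall>f \<in> fibre B x. h (badd B e f) = badd C (h e) (h f)) \<and>
     (\<forall>x c. \<forall>e \<in> fibre B x. h (bscale B c e) = bscale C c (h e))"

definition bundle_isomorphic :: "('x, 'e) vbundle \<Rightarrow> ('x, 'f) vbundle \<Rightarrow> bool" where
  "bundle_isomorphic B C \<longleftrightarrow> (\<exists>h. bundle_iso B C h)"

definition whitney_sum :: "('x, 'e) vbundle \<Rightarrow> ('x, 'f) vbundle \<Rightarrow> ('x, 'e \<times> 'f) vbundle" where
  "whitney_sum B C = \<lparr>
     tspace = subtopology (prod_topology (tspace B) (tspace C)) {(e, f). bproj B e = bproj C f},
     bproj = (\<lambda>(e, f). bproj B e),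
     badd = (\<lambda>(e, f) (e', f'). (badd B e e', badd C f f')),
     bscale = (\<lambda>c (e, f). (bscale B c e, bscale C c f))\<rparr>"

definition zero_bundle :: "'x topology \<Rightarrow> ('x, 'x) vbundle" where
  "zero_bundle X = \<lparr>tspace = X, bproj = (\<lambda>x. x), badd = (\<lambda>x _. x), bscale = (\<lambda>_ x. x)\<rparr>"

text \<open>Isomorphism classes are formed among the bundles whose total space consists of elements of
  \<open>'x \<times> (nat \<Rightarrow> complex)\<close>, with an arbitrary topology, projection and fibrewise operations.
  This loses nothing: by \<open>vector_bundle_representable\<close> below, every bundle with total space in
  any type is isomorphic to one of these.\<close>

type_synonym 'x ubundle = "('x, 'x \<times> (nat \<Rightarrow> complex)) vbundle"

definition bundle_class :: "'x topology \<Rightarrow> ('x, 'e) vbundle \<Rightarrow> 'x ubundle set" where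
  "bundle_class X B = {C. vector_bundle X C \<and> bundle_isomorphic B C}"

definition bundle_monoid :: "'x topology \<Rightarrow> 'x ubundle set monoid" where
  "bundle_monoid X = \<lparr>
     carrier = {bundle_class X B | B :: 'x ubundle. vector_bundle X B},
     mult = (\<lambda>P Q. \<Union>B\<in>P. \<Union>C\<in>Q. bundle_class X (whitney_sum B C)),
     one = bundle_class X (zero_bundle X)\<rparr>"

definition K0_group :: "'x topology \<Rightarrow> ('x ubundle set \<times> 'x ubundle set) set monoid" where
  "K0_group X = grothendieck_group (bundle_monoid X)"


section \<open>Well-definedness\<close>

lemma boolean_semigroup_simps [simp]:
  "carrier boolean_semigroup = UNIV"
  "a \<star>\<^bsub>boolean_semigroup\<^esub> b = inf a b"
  by (simp_all add: boolean_semigroup_def)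

lemma is_sinverse_boolean: "is_sinverse boolean_semigroup a b \<longleftrightarrow> b = a"
  by (auto simp: is_sinverse_def) (metis inf.commute inf.left_idem)

lemma sinv_boolean [simp]: "sinv boolean_semigroup a = a"
  by (simp add: sinv_def is_sinverse_boolean)

lemma is_szero_boolean: "is_szero boolean_semigroup z \<longleftrightarrow> z = bot"
  by (auto simp: is_szero_def) (metis inf_bot_right)

lemma szero_boolean [simp]: "szero boolean_semigroup = bot"
  by (simp add: szero_def is_szero_boolean)

lemma sle_boolean [simp]: "sle boolean_semigroup a b \<longleftrightarrow> a \<le> b"
  by (auto simp: sle_def idempotents_def) (metis inf.absorb_iff2)

lemma is_sjoin_boolean_pair: "is_sjoin boolean_semigroup {a, b} j \<longleftrightarrow> j = sup a b"
  by (auto simp: is_sjoin_def intro: order.antisym)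

lemma orthogonally_complete_boolean: "orthogonally_complete boolean_semigroup"
  by (auto simp: orthogonally_complete_def inverse_semigroup_def is_sinverse_boolean
      is_szero_boolean is_sjoin_boolean_pair inf.assoc inf_sup_distrib1 inf_sup_distrib2)

lemma openin_stone_space:
  "openin stone_space = arbitrary union_of (\<lambda>U. U \<in> range stone_basic)"
proof -
  have "stone_basic a \<inter> stone_basic b = stone_basic (inf a b)" for a b :: 'a
    by (auto simp: stone_basic_def ultrafilters_def proper_filter_def)
  then have "istopology (arbitrary union_of (\<lambda>U :: 'a set set. U \<in> range stone_basic))"
    by (intro istopology_base) auto
  then show ?thesis
    by (simp add: stone_space_def)
qed

lemma topspace_stone_space [simp]: "topspace stone_space = ultrafilters"
proof -
  have top: "- bot \<in> F" if "F \<in> ultrafilters" for F :: "'a set"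
    using that by (simp add: ultrafilters_def proper_filter_def) (metis all_not_in_conv top_greatest)
  have "openin stone_space (stone_basic (- bot :: 'a))"
    unfolding openin_stone_space by (rule union_of_inc) (auto simp: arbitrary_def)
  moreover have "stone_basic (- bot :: 'a) = ultrafilters"
    using top by (auto simp: stone_basic_def)
  moreover have "topspace stone_space \<subseteq> (ultrafilters :: 'a set set)"
    unfolding topspace_def openin_stone_space
    by (auto simp: union_of_def stone_basic_def)
  ultimately show ?thesis
    by (metis openin_subset subset_antisym)
qed


text \<open>Every bundle, with total space in an arbitrary type, has an isomorphic copy in the type used
  for \<^const>\<open>bundle_class\<close>: local trivializations embed the total space as a set.\<close>

lemma homeomorphic_map_pushforward:
  assumes "inj_on j (topspace T)"
  shows "homeomorphic_map T
    (pullback_topology (j ` topspace T) (inv_into (topspace T) j) T) j"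
proof -
  let ?k = "inv_into (topspace T) j"
  let ?T' = "pullback_topology (j ` topspace T) ?k T"
  have kj: "?k (j e) = e" if "e \<in> topspace T" for e
    using assms that by simp
  have top': "topspace ?T' = j ` topspace T"
    by (auto simp: topspace_pullback_topology kj)
  have "continuous_map T ?T' j"
    unfolding continuous_map
  proof (intro conjI allI impI)
    show "j ` topspace T \<subseteq> topspace ?T'"
      by (simp add: top')
    fix V assume "openin ?T' V"
    then obtain U where U: "openin T U" "V = ?k -` U \<inter> j ` topspace T"
      by (auto simp: openin_pullback_topology)
    have "{x \<in> topspace T. j x \<in> V} = U"
      using openin_subset[OF U(1)] by (auto simp: U(2) kj) (metis kj)
    with U(1) show "openin T {x \<in> topspace T. j x \<in> V}"
      by simp
  qed
  moreover have "open_map T ?T' j"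
    unfolding open_map_def openin_pullback_topology
  proof (intro allI impI)
    fix U assume U: "openin T U"
    then have "j ` U = ?k -` U \<inter> j ` topspace T"
      using openin_subset[OF U] by (auto simp: kj)
    with U show "\<exists>V. openin T V \<and> j ` U = ?k -` V \<inter> j ` topspace T"
      by blast
  qed
  ultimately show ?thesis
    by (intro bijective_open_imp_homeomorphic_map) (use assms top' in auto)
qed

lemma complex_vector_space_on_transport:
  assumes V: "complex_vector_space_on V add scal"
    and bij: "bij_betw j V W"
    and add: "\<And>u v. u \<in> V \<Longrightarrow> v \<in> V \<Longrightarrow> add' (j u) (j v) = j (add u v)"
    and scal: "\<And>c u. u \<in> V \<Longrightarrow> scal' c (j u) = j (scal c u)"
  shows "complex_vector_space_on W add' scal'"
proof -
  obtain z where z: "comm_group \<lparr>carrier = V, mult = add, one = z\<rparr>" (is "comm_group ?G")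
    using V by (auto simp: complex_vector_space_on_def)
  interpret G: comm_group ?G by (fact z)
  have W: "W = j ` V"
    using bij by (simp add: bij_betw_def)
  have zV: "z \<in> V" and addV: "\<And>u v. u \<in> V \<Longrightarrow> v \<in> V \<Longrightarrow> add u v \<in> V"
    using G.one_closed G.m_closed by auto
  have scalV: "\<And>c u. u \<in> V \<Longrightarrow> scal c u \<in> V"
    using V by (auto simp: complex_vector_space_on_def)
  have "comm_group \<lparr>carrier = W, mult = add', one = j z\<rparr>"
  proof (rule comm_groupI; simp)
    fix x assume "x \<in> W"
    then obtain u where u: "u \<in> V" "x = j u" using W by auto
    then show "add' (j z) x = x"
      using G.l_one[of u] zV by (simp add: add)
    obtain v where "v \<in> V" "add v u = z"
      using G.l_inv_ex[of u] u by auto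
    then show "\<exists>y\<in>W. add' y x = j z"
      using u W by (auto simp: add)
  next
    show "j z \<in> W" using zV W by simp
  next
    fix x y assume "x \<in> W" "y \<in> W"
    then obtain u v where u: "u \<in> V" "x = j u" "v \<in> V" "y = j v" using W by auto
    then show "add' x y \<in> W"
      using addV W by (simp add: add)
    show "add' x y = add' y x"
      using u G.m_comm[of u v] by (simp add: add)
    fix w assume "w \<in> W"
    then obtain t where t: "t \<in> V" "w = j t" using W by auto
    then show "add' (add' x y) w = add' x (add' y w)"
      using u G.m_assoc[of u v t] addV by (simp add: add)
  qed
  then show ?thesis
    using V addV scalV unfolding complex_vector_space_on_def W
    by (fastforce simp: add scal)
qed

lemma vector_bundle_transport:
  assumes B: "vector_bundle X B" and g: "bundle_iso C B g"
    and closed: "\<And>x. x \<in> topspace X \<Longrightarrow> \<forall>u \<in> fibre C x. \<forall>v \<in> fibre C x. badd C u v \<in> fibre C x"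
      "\<And>x. x \<in> topspace X \<Longrightarrow> \<forall>c. \<forall>u \<in> fibre C x. bscale C c u \<in> fibre C x"
  shows "vector_bundle X C"
proof -
  have hom: "homeomorphic_map (tspace C) (tspace B) g"
    and pr: "\<And>e. e \<in> topspace (tspace C) \<Longrightarrow> bproj B (g e) = bproj C e"
    and ad: "\<And>x e f. e \<in> fibre C x \<Longrightarrow> f \<in> fibre C x \<Longrightarrow> g (badd C e f) = badd B (g e) (g f)"
    and sc: "\<And>x c e. e \<in> fibre C x \<Longrightarrow> g (bscale C c e) = bscale B c (g e)"
    using g by (auto simp: bundle_iso_def)
  have gtop: "g ` topspace (tspace C) = topspace (tspace B)"
    and ginj: "inj_on g (topspace (tspace C))"
    using hom by (auto simp: homeomorphic_eq_everything_map)
  have gpre: "g ` preim C U = preim B U" for U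
    using gtop pr by (auto simp: preim_def image_iff) force
  have gmem: "g e \<in> preim B U" if "e \<in> preim C U" for e U
    using gpre[of U] that by blast
  have cont: "continuous_map (tspace C) X (bproj C)"
  proof (rule continuous_map_eq)
    show "continuous_map (tspace C) X (bproj B \<circ> g)"
      using B hom continuous_map_compose homeomorphic_imp_continuous_map
      unfolding vector_bundle_def by blast
  qed (simp add: pr)
  have vs: "complex_vector_space_on (fibre C x) (badd C) (bscale C)" if x: "x \<in> topspace X" for x
  proof -
    let ?k = "inv_into (fibre C x) g"
    have bij: "bij_betw g (fibre C x) (fibre B x)"
      using gpre[of "{x}"] inj_on_subset[OF ginj, of "fibre C x"]
      by (simp add: bij_betw_def preim_def)
    have k: "?k b \<in> fibre C x" "g (?k b) = b" if "b \<in> fibre B x" for b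
      using that gpre[of "{x}"] by (metis inv_into_into, metis f_inv_into_f)
    have kg: "?k (g e) = e" if "e \<in> fibre C x" for e
      using bij that by (simp add: bij_betw_def)
    show ?thesis
    proof (rule complex_vector_space_on_transport)
      show "complex_vector_space_on (fibre B x) (badd B) (bscale B)"
        using B x by (simp add: vector_bundle_def)
      show "bij_betw ?k (fibre B x) (fibre C x)"
        using bij by (rule bij_betw_inv_into)
      show "badd C (?k u) (?k v) = ?k (badd B u v)" if "u \<in> fibre B x" "v \<in> fibre B x" for u v
      proof -
        have "?k (g (badd C (?k u) (?k v))) = badd C (?k u) (?k v)"
          using closed(1)[OF x] k(1) that by (intro kg) blast
        then show ?thesis
          using ad[OF k(1) k(1), OF that] k(2) that by simp
      qed
      show "bscale C c (?k u) = ?k (bscale B c u)" if "u \<in> fibre B x" for c u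
      proof -
        have "?k (g (bscale C c (?k u))) = bscale C c (?k u)"
          using closed(2)[OF x] k(1) that by (intro kg) blast
        then show ?thesis
          using sc[OF k(1), OF that] k(2) that by simp
      qed
    qed
  qed
  have triv: "local_trivialization X C U n (h \<circ> g)" if h: "local_trivialization X B U n h" for U n h
  proof -
    have "homeomorphic_map (subtopology (tspace C) (preim C U)) (subtopology (tspace B) (preim B U)) g"
    proof (rule homeomorphic_map_subtopologies[OF hom])
      show "g ` (topspace (tspace C) \<inter> preim C U) = topspace (tspace B) \<inter> preim B U"
        using gpre[of U] by (simp add: preim_def Int_absorb1 Collect_conj_eq[symmetric])
    qed
    moreover have "homeomorphic_map (subtopology (tspace B) (preim B U))
       (prod_topology (subtopology X U) (complex_space n)) h"
      using h by (simp add: local_trivialization_def)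
    ultimately have "homeomorphic_map (subtopology (tspace C) (preim C U))
       (prod_topology (subtopology X U) (complex_space n)) (h \<circ> g)"
      by (rule homeomorphic_map_compose)
    moreover have "fst (h (g e)) = bproj C e" if "e \<in> preim C U" for e
      using h gmem[OF that] pr[of e] that by (simp add: local_trivialization_def) (simp add: preim_def)
    moreover have "snd (h (g (badd C e f))) = (\<lambda>i. snd (h (g e)) i + snd (h (g f)) i)"
      if "x \<in> U" "e \<in> fibre C x" "f \<in> fibre C x" for x e f
      using h gmem that by (simp add: ad[OF that(2,3)] local_trivialization_def)
    moreover have "snd (h (g (bscale C c e))) = (\<lambda>i. c * snd (h (g e)) i)"
      if "x \<in> U" "e \<in> fibre C x" for x c e
      using h gmem that by (simp add: sc[OF that(2)] local_trivialization_def)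
    ultimately show ?thesis
      using h by (simp add: local_trivialization_def)
  qed
  show ?thesis
    using B cont vs triv unfolding vector_bundle_def by meson
qed

theorem vector_bundle_representable:
  fixes X :: "'x topology" and B :: "('x, 'e) vbundle"
  assumes B: "vector_bundle X B"
  obtains C :: "'x ubundle" where "vector_bundle X C" "bundle_isomorphic B C"
proof -
  have "\<forall>x. \<exists>h. x \<in> topspace X \<longrightarrow> (\<exists>U n. x \<in> U \<and> local_trivialization X B U n h)"
    using B unfolding vector_bundle_def by metis
  then obtain h where h: "\<And>x. x \<in> topspace X \<Longrightarrow> \<exists>U n. x \<in> U \<and> local_trivialization X B U n (h x)"
    by metis
  define j where "j = (\<lambda>e. h (bproj B e) e)"
  have prX: "bproj B e \<in> topspace X" if "e \<in> topspace (tspace B)" for e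
    using B that by (auto simp: vector_bundle_def continuous_map_def)
  have fstj: "fst (j e) = bproj B e" if e: "e \<in> topspace (tspace B)" for e
    using h[OF prX[OF e]] e by (auto simp: j_def local_trivialization_def preim_def)
  have inj: "inj_on j (topspace (tspace B))"
  proof (rule inj_onI)
    fix e f assume ef: "e \<in> topspace (tspace B)" "f \<in> topspace (tspace B)" "j e = j f"
    then have eq: "bproj B e = bproj B f"
      by (metis fstj)
    obtain U n where U: "bproj B e \<in> U" "local_trivialization X B U n (h (bproj B e))"
      using h[OF prX[OF ef(1)]] by blast
    then have "inj_on (h (bproj B e)) (topspace (subtopology (tspace B) (preim B U)))"
      by (simp add: local_trivialization_def homeomorphic_map_def)
    then have "inj_on (h (bproj B e)) (preim B U)"
      by (rule inj_on_subset) (auto simp: preim_def)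
    moreover have "e \<in> preim B U" "f \<in> preim B U"
      using ef eq U(1) by (auto simp: preim_def)
    ultimately show "e = f"
      using ef(3) eq by (auto simp: j_def inj_on_def)
  qed
  define k where "k = inv_into (topspace (tspace B)) j"
  have kj [simp]: "k (j e) = e" if "e \<in> topspace (tspace B)" for e
    using inj that by (simp add: k_def)
  define C :: "'x ubundle" where "C = \<lparr>
     tspace = pullback_topology (j ` topspace (tspace B)) k (tspace B),
     bproj = bproj B \<circ> k,
     badd = (\<lambda>u v. j (badd B (k u) (k v))),
     bscale = (\<lambda>c u. j (bscale B c (k u)))\<rparr>"
  have hom: "homeomorphic_map (tspace B) (tspace C) j"
    using homeomorphic_map_pushforward[OF inj] by (simp add: C_def k_def)
  have topC: "topspace (tspace C) = j ` topspace (tspace B)"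
    using hom homeomorphic_imp_surjective_map by metis
  have fibB: "badd B e f \<in> fibre B x" "bscale B c e \<in> fibre B x"
    if "e \<in> fibre B x" "f \<in> fibre B x" for x c e f
  proof -
    have "x \<in> topspace X"
      using that prX by (auto simp: preim_def)
    then have V: "complex_vector_space_on (fibre B x) (badd B) (bscale B)"
      using B by (simp add: vector_bundle_def)
    then obtain z where "comm_group \<lparr>carrier = fibre B x, mult = badd B, one = z\<rparr>"
      by (auto simp: complex_vector_space_on_def)
    then interpret G: comm_group "\<lparr>carrier = fibre B x, mult = badd B, one = z\<rparr>" .
    show "badd B e f \<in> fibre B x"
      using G.m_closed that by simp
    show "bscale B c e \<in> fibre B x"
      using V that by (simp add: complex_vector_space_on_def)
  qed
  have fibC: "fibre C x = j ` fibre B x" for x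
    by (auto simp: preim_def topC) (auto simp: C_def)
  have isoBC: "bundle_iso B C j"
    unfolding bundle_iso_def using hom by (auto simp: C_def preim_def)
  have kC: "homeomorphic_map (tspace C) (tspace B) k"
  proof -
    obtain g where g: "homeomorphic_maps (tspace B) (tspace C) j g"
      using hom by (auto simp: homeomorphic_map_maps)
    then have "homeomorphic_map (tspace C) (tspace B) g"
      by (simp add: homeomorphic_maps_map)
    moreover have "g u = k u" if "u \<in> topspace (tspace C)" for u
      using that g by (auto simp: topC homeomorphic_maps_def)
    ultimately show ?thesis
      by (rule homeomorphic_map_eq)
  qed
  have isoCB: "bundle_iso C B k"
    unfolding bundle_iso_def
  proof (intro conjI kC ballI allI)
    fix e assume "e \<in> topspace (tspace C)"
    then show "bproj B (k e) = bproj C e"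
      by (simp add: C_def)
  next
    fix x e f assume "e \<in> fibre C x" "f \<in> fibre C x"
    then obtain e' f' where ef: "e' \<in> fibre B x" "f' \<in> fibre B x" "e = j e'" "f = j f'"
      by (auto simp: fibC)
    then show "k (badd C e f) = badd B (k e) (k f)"
      using fibB(1)[OF ef(1,2)] by (simp add: C_def preim_def)
  next
    fix x c e assume "e \<in> fibre C x"
    then obtain e' where ef: "e' \<in> fibre B x" "e = j e'"
      by (auto simp: fibC)
    then show "k (bscale C c e) = bscale B c (k e)"
      using fibB(2)[OF ef(1,1)] by (simp add: C_def preim_def)
  qed
  have "vector_bundle X C"
  proof (rule vector_bundle_transport[OF B isoCB]; intro ballI allI)
    fix x u v assume "u \<in> fibre C x" "v \<in> fibre C x"
    then obtain e f where "e \<in> fibre B x" "f \<in> fibre B x" "u = j e" "v = j f"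
      by (auto simp: fibC)
    then show "badd C u v \<in> fibre C x"
      using fibB(1)[of e x f] unfolding fibC by (simp add: C_def preim_def)
  next
    fix x c u assume "u \<in> fibre C x"
    then obtain e where "e \<in> fibre B x" "u = j e"
      by (auto simp: fibC)
    then show "bscale C c u \<in> fibre C x"
      using fibB(2)[of e x e c] unfolding fibC by (simp add: C_def preim_def)
  qed
  then show ?thesis
    using that isoBC unfolding bundle_isomorphic_def by blast
qed

end

theory Submission
  imports Defs "HOL-Library.Function_Algebras"
begin

text \<open>
  Let \<open>X\<close> be the Stone space of the Boolean algebra \<open>S\<close>. Both \<open>K(S)\<close> and \<open>K\<^sup>0(X)\<close> are
  Grothendieck groups of commutative monoids, and both monoids are the monoid of continuous functions
  \<open>X \<rightarrow> \<nat>\<close> in disguise: a class is determined by its rank, a function on \<open>X\<close>, every continuous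
  function is a rank, and ranks add. Since every continuous \<open>f : X \<rightarrow> \<int>\<close> is the difference of its
  positive and negative parts, the Grothendieck group of that monoid is \<open>Z(X)\<close>
  (\<open>grothendieck_group_rank_functions\<close>).

  For \<open>K(S)\<close>, a matrix over \<open>S\<close> is read pointwise: at an ultrafilter \<open>U\<close> the pairs \<open>(i, j)\<close> with
  \<open>A i j \<in> U\<close> form a finite partial bijection of \<open>\<nat>\<close>. Ultrafilters are prime and separate the elements
  of \<open>S\<close>, so the product of matrices becomes composition of relations, the inverse becomes the converse,
  and an idempotent becomes a finite subset of \<open>\<nat>\<close> varying continuously with \<open>U\<close>. Its rank at \<open>U\<close> is
  the cardinality of this subset. Two idempotents of the same rank are \<open>\<D>\<close>-related through the matrix
  that, at each \<open>U\<close>, matches the two subsets in increasing order; its entries exist in \<open>S\<close> because, by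
  compactness, the clopen sets of \<open>X\<close> are the sets of ultrafilters containing a given element
  (\<open>green_D_boolean_matrices_iff\<close>).

  For \<open>K\<^sup>0(X)\<close>, compactness and the base of clopen sets give more than local triviality: a locally
  constant choice of one trivialization at each point. Glued together, these identify any bundle with the
  standard bundle whose fibre at \<open>x\<close> is \<open>\<complex>\<^bsup>r x\<^esup>\<close> for a locally constant \<open>r\<close>
  (\<open>vector_bundle_isomorphic_standard_bundle\<close>). Invariance of dimension shows that \<open>r\<close> is determined
  by the bundle, and the Whitney sum of standard bundles is the standard bundle of the sum of the ranks.
\<close>


section \<open>Continuous functions to discrete spaces\<close>

lemma continuous_map_discrete_iff:
  "continuous_map X (discrete_topology UNIV) f \<longleftrightarrow> (\<forall>y. openin X {x \<in> topspace X. f x = y})"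
proof
  assume f: "continuous_map X (discrete_topology UNIV) f"
  show "\<forall>y. openin X {x \<in> topspace X. f x = y}"
    using openin_continuous_map_preimage[OF f, of "{y}" for y] by simp
next
  assume f: "\<forall>y. openin X {x \<in> topspace X. f x = y}"
  show "continuous_map X (discrete_topology UNIV) f"
    unfolding continuous_map
  proof (intro conjI allI impI)
    fix U
    have "{x \<in> topspace X. f x \<in> U} = (\<Union>y\<in>U. {x \<in> topspace X. f x = y})"
      by auto
    with f show "openin X {x \<in> topspace X. f x \<in> U}"
      by auto
  qed auto
qed

lemma continuous_map_discrete_const: "continuous_map X (discrete_topology UNIV) (\<lambda>_. c)"
  by simp

lemma continuous_map_discrete_comp2:
  assumes f: "continuous_map X (discrete_topology UNIV) f"
    and g: "continuous_map X (discrete_topology UNIV) g"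
  shows "continuous_map X (discrete_topology UNIV) (\<lambda>x. h (f x) (g x))"
  unfolding continuous_map_discrete_iff
proof
  fix y
  have "{x \<in> topspace X. h (f x) (g x) = y} =
    (\<Union>(u, v) \<in> {(u, v). h u v = y}. {x \<in> topspace X. f x = u} \<inter> {x \<in> topspace X. g x = v})"
    by auto
  moreover have "openin X \<dots>"
    using f g unfolding continuous_map_discrete_iff by (intro openin_Union ballI) (clarsimp, intro openin_Int; blast)
  ultimately show "openin X {x \<in> topspace X. h (f x) (g x) = y}"
    by simp
qed

lemma continuous_map_discrete_restrict:
  assumes "continuous_map X (discrete_topology UNIV) f"
  shows "continuous_map X (discrete_topology UNIV) (\<lambda>x\<in>topspace X. f x)"
  using assms by (rule continuous_map_eq) simp

lemma continuous_map_discrete_if: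
  assumes "continuous_map X (discrete_topology UNIV) f"
  shows "continuous_map X (discrete_topology UNIV) (\<lambda>x. if x \<in> topspace X then f x else c)"
  using assms by (rule continuous_map_eq) simp

text \<open>The gluing principle for locally constant case distinctions: the parameter \<open>q t\<close> of the
  family \<open>F\<close> is locally constant, so near any point only one member of the family matters.\<close>

lemma continuous_map_discrete_family:
  assumes q: "continuous_map T (discrete_topology UNIV) q"
    and F: "\<And>t. t \<in> topspace T \<Longrightarrow>
      continuous_map (subtopology T {s \<in> topspace T. q s = q t}) T' (F (q t))"
  shows "continuous_map T T' (\<lambda>t. F (q t) t)"
  unfolding continuous_map
proof (intro conjI allI impI)
  let ?W = "\<lambda>p. {s \<in> topspace T. q s = p}"
  show "(\<lambda>t. F (q t) t) ` topspace T \<subseteq> topspace T'"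
  proof (rule image_subsetI)
    fix t assume t: "t \<in> topspace T"
    then have "t \<in> topspace (subtopology T (?W (q t)))"
      by simp
    then show "F (q t) t \<in> topspace T'"
      using continuous_map_image_subset_topspace[OF F[OF t]] by blast
  qed
  fix V assume V: "openin T' V"
  let ?P = "\<lambda>p. {s \<in> topspace (subtopology T (?W p)). F p s \<in> V}"
  have eq: "{t \<in> topspace T. F (q t) t \<in> V} = (\<Union>p\<in>q ` topspace T. ?P p)"
    by auto
  have "openin T (?P p)" if p: "p \<in> q ` topspace T" for p
  proof -
    obtain t where t: "t \<in> topspace T" "p = q t"
      using p by blast
    have "openin (subtopology T (?W p)) (?P p)"
      using openin_continuous_map_preimage[OF F[OF t(1)] V] t(2) by simp
    moreover have "openin T (?W p)"
      using q unfolding continuous_map_discrete_iff by blast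
    ultimately show ?thesis
      by (simp add: openin_open_subtopology)
  qed
  then show "openin T {t \<in> topspace T. F (q t) t \<in> V}"
    unfolding eq by (intro openin_Union) blast
qed

lemma continuous_map_discrete_compose:
  assumes "continuous_map T X p" "continuous_map X (discrete_topology UNIV) q"
  shows "continuous_map T (discrete_topology UNIV) (\<lambda>t. q (p t))"
  using continuous_map_compose[OF assms] by (simp add: o_def)

section \<open>The Grothendieck group of the natural-valued functions\<close>

lemma comm_group_continuous_int_group: "comm_group (continuous_int_group X)"
proof (rule comm_groupI)
  let ?Z = "continuous_int_group X"
  have cl: "(\<lambda>x\<in>topspace X. h (f x) (g x)) \<in> carrier ?Z"
    if "f \<in> carrier ?Z" "g \<in> carrier ?Z" for f g and h :: "int \<Rightarrow> int \<Rightarrow> int"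
    using that continuous_map_discrete_comp2[of X f g h]
    by (simp add: continuous_int_group_def continuous_map_discrete_restrict)
  show "f \<otimes>\<^bsub>?Z\<^esub> g \<in> carrier ?Z" if "f \<in> carrier ?Z" "g \<in> carrier ?Z" for f g
    using cl[OF that, of "(+)"] by (simp add: continuous_int_group_def)
  show "\<one>\<^bsub>?Z\<^esub> \<in> carrier ?Z"
    by (simp add: continuous_int_group_def continuous_map_discrete_restrict)
  show "f \<otimes>\<^bsub>?Z\<^esub> g \<otimes>\<^bsub>?Z\<^esub> k = f \<otimes>\<^bsub>?Z\<^esub> (g \<otimes>\<^bsub>?Z\<^esub> k)" for f g k
    by (simp add: continuous_int_group_def fun_eq_iff)
  show "f \<otimes>\<^bsub>?Z\<^esub> g = g \<otimes>\<^bsub>?Z\<^esub> f" for f g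
    by (simp add: continuous_int_group_def fun_eq_iff)
  show "\<one>\<^bsub>?Z\<^esub> \<otimes>\<^bsub>?Z\<^esub> f = f" if "f \<in> carrier ?Z" for f
    using that by (auto simp: continuous_int_group_def fun_eq_iff extensional_def)
  show "\<exists>g\<in>carrier ?Z. g \<otimes>\<^bsub>?Z\<^esub> f = \<one>\<^bsub>?Z\<^esub>" if "f \<in> carrier ?Z" for f
    using cl[OF that that, of "\<lambda>u _. - u"]
    by (intro bexI[of _ "\<lambda>x\<in>topspace X. - f x"])
       (simp_all add: continuous_int_group_def fun_eq_iff)
qed

text \<open>The continuous functions \<open>X \<rightarrow> \<nat>\<close>. The value \<open>0\<close> outside the space makes equality of
  functions the same as equality on \<open>X\<close>, and is compatible with pointwise sums.\<close>

definition rank_functions :: "'x topology \<Rightarrow> ('x \<Rightarrow> nat) set" where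
  "rank_functions X =
    {f. continuous_map X (discrete_topology UNIV) f \<and> (\<forall>x. x \<notin> topspace X \<longrightarrow> f x = 0)}"

lemma rank_functions_add:
  "f \<in> rank_functions X \<Longrightarrow> g \<in> rank_functions X \<Longrightarrow> (\<lambda>x. f x + g x) \<in> rank_functions X"
  by (auto simp: rank_functions_def intro: continuous_map_discrete_comp2)

lemma rank_functions_zero: "(\<lambda>_. 0) \<in> rank_functions X"
  by (simp add: rank_functions_def)

text \<open>The monoid \<open>M\<close> is a copy, along \<open>cls\<close>, of the cancellative monoid of continuous functions
  \<open>X \<rightarrow> \<nat>\<close>. A formal difference \<open>(cls a, cls b)\<close> is therefore determined by \<open>a - b\<close>, and \<open>f\<close> corresponds
  to the formal difference of its positive and negative parts.\<close>

lemma grothendieck_group_rank_functions: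
  fixes M :: "('m, 'z) monoid_scheme" and X :: "'x topology"
  assumes carr: "carrier M = cls ` rank_functions X"
    and inj: "inj_on cls (rank_functions X)"
    and mult: "\<And>f g. f \<in> rank_functions X \<Longrightarrow> g \<in> rank_functions X \<Longrightarrow>
      cls f \<otimes>\<^bsub>M\<^esub> cls g = cls (\<lambda>x. f x + g x)"
    and one: "\<one>\<^bsub>M\<^esub> = cls (\<lambda>_. 0)"
  shows "comm_group (grothendieck_group M)"
    and "continuous_int_group X \<cong> grothendieck_group M"
proof -
  let ?N = "rank_functions X" and ?R = "grothendieck_rel M" and ?G = "grothendieck_group M"
  let ?Z = "continuous_int_group X"
  have eq: "cls f = cls g \<longleftrightarrow> f = g" if "f \<in> ?N" "g \<in> ?N" for f g
    using inj that by (auto simp: inj_on_def)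
  have add: "(\<lambda>x. f x + g x) \<in> ?N" if "f \<in> ?N" "g \<in> ?N" for f g
    using that by (rule rank_functions_add)
  \<comment> \<open>\<open>K a b\<close> is the class of the formal difference \<open>(cls a, cls b)\<close>.\<close>
  define K where "K = (\<lambda>a b. {(cls c, cls d) | c d. c \<in> ?N \<and> d \<in> ?N \<and> (\<forall>x. a x + d x = c x + b x)})"
  have relD: "((cls a, cls b), (cls c, cls d)) \<in> ?R \<longleftrightarrow> (\<forall>x. a x + d x = c x + b x)"
    if "a \<in> ?N" "b \<in> ?N" "c \<in> ?N" "d \<in> ?N" for a b c d
  proof -
    have "((cls a, cls b), (cls c, cls d)) \<in> ?R \<longleftrightarrow>
      (\<exists>k\<in>?N. (\<lambda>x. a x + d x + k x) = (\<lambda>x. c x + b x + k x))"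
      using that by (auto simp: grothendieck_rel_def carr mult add eq)
    also have "\<dots> \<longleftrightarrow> (\<forall>x. a x + d x = c x + b x)"
      using rank_functions_zero[of X] by (auto simp: fun_eq_iff)
    finally show ?thesis .
  qed
  have Kimg: "?R `` {(cls a, cls b)} = K a b" if ab: "a \<in> ?N" "b \<in> ?N" for a b
  proof -
    have R: "?R \<subseteq> UNIV \<times> (cls ` ?N \<times> cls ` ?N)"
      by (auto simp: grothendieck_rel_def carr)
    show ?thesis
    proof (intro equalityI subsetI)
      fix p assume p: "p \<in> ?R `` {(cls a, cls b)}"
      then obtain c d where "c \<in> ?N" "d \<in> ?N" "p = (cls c, cls d)"
        using R by blast
      then show "p \<in> K a b"
        using p relD[OF ab, of c d] by (auto simp: K_def)
    next
      fix p assume "p \<in> K a b"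
      then obtain c d where "c \<in> ?N" "d \<in> ?N" "p = (cls c, cls d)" "\<forall>x. a x + d x = c x + b x"
        by (auto simp: K_def)
      then show "p \<in> ?R `` {(cls a, cls b)}"
        using relD[OF ab, of c d] by simp
    qed
  qed
  have carrG: "carrier ?G = {K a b | a b. a \<in> ?N \<and> b \<in> ?N}"
  proof -
    have "carrier ?G = (\<Union>p\<in>cls ` ?N \<times> cls ` ?N. {?R `` {p}})"
      by (simp add: grothendieck_group_def quotient_def carr)
    also have "\<dots> = {?R `` {(cls a, cls b)} | a b. a \<in> ?N \<and> b \<in> ?N}"
      by blast
    also have "\<dots> = {K a b | a b. a \<in> ?N \<and> b \<in> ?N}"
      using Kimg by (metis (no_types, lifting))
    finally show ?thesis .
  qed
  have Keq: "K a b = K c d \<longleftrightarrow> (\<forall>x. a x + d x = c x + b x)"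
    if "a \<in> ?N" "b \<in> ?N" "c \<in> ?N" "d \<in> ?N" for a b c d
  proof
    assume "K a b = K c d"
    moreover have "(cls c, cls d) \<in> K c d"
      using that by (auto simp: K_def)
    ultimately have "(cls c, cls d) \<in> K a b"
      by simp
    then show "\<forall>x. a x + d x = c x + b x"
      using that by (auto simp: K_def eq)
  next
    assume *: "\<forall>x. a x + d x = c x + b x"
    have "a x + v = u + b x \<longleftrightarrow> c x + v = u + d x" for x u v
      using *[rule_format, of x] by linarith
    then show "K a b = K c d"
      by (simp add: K_def)
  qed
  have Kmult: "K a b \<otimes>\<^bsub>?G\<^esub> K c d = K (\<lambda>x. a x + c x) (\<lambda>x. b x + d x)"
    if abcd: "a \<in> ?N" "b \<in> ?N" "c \<in> ?N" "d \<in> ?N" for a b c d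
  proof -
    have *: "?R `` {(cls a' \<otimes>\<^bsub>M\<^esub> cls c', cls b' \<otimes>\<^bsub>M\<^esub> cls d')} = K (\<lambda>x. a x + c x) (\<lambda>x. b x + d x)"
      if "a' \<in> ?N" "b' \<in> ?N" "c' \<in> ?N" "d' \<in> ?N"
        "\<forall>x. a x + b' x = a' x + b x" "\<forall>x. c x + d' x = c' x + d x" for a' b' c' d'
    proof -
      have "?R `` {(cls a' \<otimes>\<^bsub>M\<^esub> cls c', cls b' \<otimes>\<^bsub>M\<^esub> cls d')} = K (\<lambda>x. a' x + c' x) (\<lambda>x. b' x + d' x)"
        using that by (simp add: mult add Kimg)
      also have "\<dots> = K (\<lambda>x. a x + c x) (\<lambda>x. b x + d x)"
        unfolding Keq[OF add[OF that(1,3)] add[OF that(2,4)] add[OF abcd(1,3)] add[OF abcd(2,4)]]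
      proof
        fix x
        show "a' x + c' x + (b x + d x) = a x + c x + (b' x + d' x)"
          using that(5,6)[rule_format, of x] by linarith
      qed
      finally show ?thesis .
    qed
    have K: "(cls a, cls b) \<in> K a b" "(cls c, cls d) \<in> K c d"
      using abcd by (auto simp: K_def)
    have const: "?R `` {(p \<otimes>\<^bsub>M\<^esub> r, q \<otimes>\<^bsub>M\<^esub> s)} = K (\<lambda>x. a x + c x) (\<lambda>x. b x + d x)"
      if "(p, q) \<in> K a b" "(r, s) \<in> K c d" for p q r s
      using that * unfolding K_def by blast
    have "(\<Union>(p, q)\<in>K a b. \<Union>(r, s)\<in>K c d. ?R `` {(p \<otimes>\<^bsub>M\<^esub> r, q \<otimes>\<^bsub>M\<^esub> s)}) =
        (\<Union>_\<in>K a b. \<Union>_\<in>K c d. K (\<lambda>x. a x + c x) (\<lambda>x. b x + d x))"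
      by (intro SUP_cong refl; clarify; intro SUP_cong refl; clarify; rule const)
    also have "\<dots> = K (\<lambda>x. a x + c x) (\<lambda>x. b x + d x)"
      using K by auto
    finally have "(\<Union>(p, q)\<in>K a b. \<Union>(r, s)\<in>K c d. ?R `` {(p \<otimes>\<^bsub>M\<^esub> r, q \<otimes>\<^bsub>M\<^esub> s)}) =
        K (\<lambda>x. a x + c x) (\<lambda>x. b x + d x)" .
    then show ?thesis
      by (simp add: grothendieck_group_def)
  qed
  have Kone: "\<one>\<^bsub>?G\<^esub> = K (\<lambda>_. 0) (\<lambda>_. 0)"
    by (simp add: grothendieck_group_def one Kimg rank_functions_zero)
  define pos :: "('x \<Rightarrow> int) \<Rightarrow> 'x \<Rightarrow> nat"
    where "pos = (\<lambda>f x. if x \<in> topspace X then nat (f x) else 0)"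
  define neg :: "('x \<Rightarrow> int) \<Rightarrow> 'x \<Rightarrow> nat"
    where "neg = (\<lambda>f x. if x \<in> topspace X then nat (- f x) else 0)"
  have posneg: "pos f \<in> ?N" "neg f \<in> ?N" if "f \<in> carrier ?Z" for f
    using that continuous_map_discrete_comp2[of X f f "\<lambda>u v. nat u"]
      continuous_map_discrete_comp2[of X f f "\<lambda>u v. nat (- u)"]
    by (auto simp: pos_def neg_def rank_functions_def continuous_int_group_def
        intro!: continuous_map_discrete_if)
  define \<Theta> where "\<Theta> = (\<lambda>f. K (pos f) (neg f))"
  have "\<Theta> \<in> hom ?Z ?G"
  proof (rule homI)
    fix f g assume f: "f \<in> carrier ?Z" and g: "g \<in> carrier ?Z"
    show "\<Theta> f \<in> carrier ?G"
      using posneg[OF f] by (auto simp: carrG \<Theta>_def)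
    have fg: "f \<otimes>\<^bsub>?Z\<^esub> g \<in> carrier ?Z"
      using f g comm_group_continuous_int_group[of X]
      by (simp add: comm_group_def group_def monoid.m_closed)
    have "\<Theta> f \<otimes>\<^bsub>?G\<^esub> \<Theta> g = K (\<lambda>x. pos f x + pos g x) (\<lambda>x. neg f x + neg g x)"
      using posneg[OF f] posneg[OF g] by (simp add: \<Theta>_def Kmult)
    also have "\<dots> = \<Theta> (f \<otimes>\<^bsub>?Z\<^esub> g)"
      unfolding \<Theta>_def using posneg[OF f] posneg[OF g] posneg[OF fg]
      by (subst Keq) (auto simp: add pos_def neg_def continuous_int_group_def)
    finally show "\<Theta> (f \<otimes>\<^bsub>?Z\<^esub> g) = \<Theta> f \<otimes>\<^bsub>?G\<^esub> \<Theta> g" ..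
  qed
  moreover have "inj_on \<Theta> (carrier ?Z)"
  proof (rule inj_onI)
    fix f g assume f: "f \<in> carrier ?Z" and g: "g \<in> carrier ?Z" and "\<Theta> f = \<Theta> g"
    then have *: "pos f x + neg g x = pos g x + neg f x" for x
      using posneg[OF f] posneg[OF g] by (simp add: \<Theta>_def Keq)
    show "f = g"
    proof (rule extensionalityI)
      show "f x = g x" if "x \<in> topspace X" for x
        using *[of x] that by (simp add: pos_def neg_def split: if_splits)
    qed (use f g in \<open>auto simp: continuous_int_group_def\<close>)
  qed
  moreover have "carrier ?G \<subseteq> \<Theta> ` carrier ?Z"
  proof
    fix P assume "P \<in> carrier ?G"
    then obtain a b where ab: "a \<in> ?N" "b \<in> ?N" "P = K a b"
      by (auto simp: carrG)
    define f where "f = (\<lambda>x\<in>topspace X. int (a x) - int (b x))"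
    have f: "f \<in> carrier ?Z"
      using ab continuous_map_discrete_comp2[of X a b "\<lambda>u v. int u - int v"]
      by (auto simp: f_def continuous_int_group_def rank_functions_def
          intro!: continuous_map_discrete_restrict)
    have "K a b = \<Theta> f"
      unfolding \<Theta>_def Keq[OF ab(1,2) posneg[OF f]]
      using ab(1,2) by (auto simp: pos_def neg_def f_def rank_functions_def)
    with f ab(3) show "P \<in> \<Theta> ` carrier ?Z"
      by simp
  qed
  ultimately have iso: "\<Theta> \<in> iso ?Z ?G"
    by (auto simp: iso_def bij_betw_def hom_def)
  then show "?Z \<cong> ?G"
    by (auto simp: is_iso_def)
  interpret Z: comm_group ?Z
    by (rule comm_group_continuous_int_group)
  have Z0: "pos \<one>\<^bsub>?Z\<^esub> = (\<lambda>_. 0)" "neg \<one>\<^bsub>?Z\<^esub> = (\<lambda>_. 0)"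
    by (auto simp: pos_def neg_def continuous_int_group_def)
  have "\<Theta> \<one>\<^bsub>?Z\<^esub> = \<one>\<^bsub>?G\<^esub>"
    by (simp only: \<Theta>_def Z0 Kone)
  then show "comm_group ?G"
    using Z.iso_imp_img_comm_group[OF iso] by simp
qed

section \<open>Ultrafilters and the Stone space\<close>

lemma ultrafilterD:
  assumes "U \<in> ultrafilters"
  shows "bot \<notin> U" "- bot \<in> U" "a \<in> U \<Longrightarrow> a \<le> b \<Longrightarrow> b \<in> U"
    "inf a b \<in> U \<longleftrightarrow> a \<in> U \<and> b \<in> U"
proof -
  have U: "proper_filter U"
    using assms by (simp add: ultrafilters_def)
  then have up: "b \<in> U" if "a \<in> U" "a \<le> b" for a b
    using that unfolding proper_filter_def by blast
  then show "a \<in> U \<Longrightarrow> a \<le> b \<Longrightarrow> b \<in> U" .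
  show "bot \<notin> U"
    using U by (simp add: proper_filter_def)
  obtain c where "c \<in> U"
    using U unfolding proper_filter_def by blast
  then show "- bot \<in> U"
    by (rule up) simp
  have "inf a b \<in> U" if "a \<in> U" "b \<in> U"
    using U that unfolding proper_filter_def by blast
  then show "inf a b \<in> U \<longleftrightarrow> a \<in> U \<and> b \<in> U"
    using up[of "inf a b" a] up[of "inf a b" b] by auto
qed

text \<open>Maximality in the form used everywhere below: if \<open>a \<notin> U\<close>, the filter generated by \<open>U\<close> and
  \<open>a\<close> is strictly larger, hence not proper, and this puts \<open>- a\<close> into \<open>U\<close>.\<close>

lemma compl_mem_ultrafilter:
  assumes U: "U \<in> ultrafilters"
  shows "- a \<in> U \<longleftrightarrow> a \<notin> U"
proof
  show "a \<notin> U" if "- a \<in> U"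
    using ultrafilterD(1,4)[OF U] that by (metis inf_compl_bot)
next
  assume a: "a \<notin> U"
  have pf: "proper_filter U" and max: "\<And>G. proper_filter G \<Longrightarrow> U \<subseteq> G \<Longrightarrow> G = U"
    using U by (auto simp: ultrafilters_def)
  define G where "G = {b. \<exists>u\<in>U. inf u a \<le> b}"
  have "U \<subseteq> G" "a \<in> G"
    using ultrafilterD(2)[OF U] by (force simp: G_def)+
  with a max have "\<not> proper_filter G"
    by blast
  moreover have "b' \<in> G" if "b \<in> G" "b \<le> b'" for b b'
    using that by (auto simp: G_def intro: order_trans)
  moreover have "inf b b' \<in> G" if "b \<in> G" "b' \<in> G" for b b'
  proof -
    obtain u u' where "u \<in> U" "u' \<in> U" "inf u a \<le> b" "inf u' a \<le> b'"
      using \<open>b \<in> G\<close> \<open>b' \<in> G\<close> by (auto simp: G_def)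
    then have "inf u u' \<in> U" "inf (inf u u') a \<le> inf b b'"
      using ultrafilterD(4)[OF U, of u u'] inf_mono[of "inf u a" b "inf u' a" b']
      by (simp_all add: inf_commute inf_left_commute inf_assoc)
    then show ?thesis
      by (auto simp: G_def)
  qed
  ultimately have "bot \<in> G"
    using \<open>a \<in> G\<close> unfolding proper_filter_def by blast
  then obtain u where "u \<in> U" "inf u a = bot"
    by (auto simp: G_def bot_unique)
  then have "u \<le> - a"
    by (simp add: inf_shunt)
  with \<open>u \<in> U\<close> show "- a \<in> U"
    by (rule ultrafilterD(3)[OF U])
qed

lemma sup_mem_ultrafilter:
  assumes U: "U \<in> ultrafilters"
  shows "sup a b \<in> U \<longleftrightarrow> a \<in> U \<or> b \<in> U"
  using compl_mem_ultrafilter[OF U] ultrafilterD(4)[OF U]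
  by (metis compl_sup)

lemma proper_filter_extends_to_ultrafilter:
  assumes F: "proper_filter F"
  obtains U where "U \<in> ultrafilters" "F \<subseteq> U"
proof -
  let ?A = "{G. proper_filter G \<and> F \<subseteq> G}"
  have "\<exists>M\<in>?A. \<forall>G\<in>?A. M \<subseteq> G \<longrightarrow> G = M"
  proof (rule subset_Zorn_nonempty)
    show "?A \<noteq> {}"
      using F by blast
  next
    fix C assume C: "C \<noteq> {}" "subset.chain ?A C"
    have up: "b \<in> \<Union>C" if "a \<in> \<Union>C" "a \<le> b" for a b
      using C(2) that by (force simp: subset_chain_def proper_filter_def)
    have meet: "inf a b \<in> \<Union>C" if ab: "a \<in> \<Union>C" "b \<in> \<Union>C" for a b
    proof -
      obtain G H where "G \<in> C" "H \<in> C" "a \<in> G" "b \<in> H"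
        using ab by blast
      moreover have "G \<subseteq> H \<or> H \<subseteq> G"
        using C(2) \<open>G \<in> C\<close> \<open>H \<in> C\<close> unfolding subset_chain_def by blast
      ultimately obtain K where "K \<in> C" "a \<in> K" "b \<in> K"
        by blast
      then show ?thesis
        using C(2) by (force simp: subset_chain_def proper_filter_def)
    qed
    have sub: "proper_filter G \<and> F \<subseteq> G" if "G \<in> C" for G
      using C(2) that unfolding subset_chain_def by blast
    obtain G where "G \<in> C"
      using C(1) by blast
    then have "F \<subseteq> \<Union>C"
      using sub by blast
    moreover have "proper_filter (\<Union>C)"
      unfolding proper_filter_def
    proof (intro conjI ballI allI impI)
      have "F \<noteq> {}"
        using F by (simp add: proper_filter_def)
      with \<open>F \<subseteq> \<Union>C\<close> show "\<Union>C \<noteq> {}"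
        by (metis subset_empty)
      have "bot \<notin> G" if "G \<in> C" for G
        using sub[OF that] by (simp add: proper_filter_def)
      then show "bot \<notin> \<Union>C"
        by blast
    qed (fact up, fact meet)
    ultimately show "\<Union>C \<in> ?A"
      by simp
  qed
  then obtain M where M: "proper_filter M" "F \<subseteq> M" and max: "\<forall>G\<in>?A. M \<subseteq> G \<longrightarrow> G = M"
    by (metis (no_types, lifting) mem_Collect_eq)
  have "G = M" if "proper_filter G" "M \<subseteq> G" for G
    using max that M(2) by blast
  with M(1) have "M \<in> ultrafilters"
    by (simp add: ultrafilters_def)
  with M(2) show thesis
    using that by blast
qed

lemma stone_basic_Union:
  assumes "finite A"
  obtains b where "stone_basic b = (\<Union>a\<in>A. stone_basic a)"
proof -
  have "\<exists>b. stone_basic b = (\<Union>a\<in>A. stone_basic a)"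
    using assms
  proof (induction A)
    case empty
    have "stone_basic (bot :: 'a) = {}"
      by (auto simp: stone_basic_def ultrafilterD)
    then show ?case by auto
  next
    case (insert a A)
    then obtain b where "stone_basic b = (\<Union>a\<in>A. stone_basic a)"
      by blast
    moreover have "stone_basic (sup a b) = stone_basic a \<union> stone_basic b"
      by (auto simp: stone_basic_def sup_mem_ultrafilter)
    ultimately have "stone_basic (sup a b) = (\<Union>a\<in>insert a A. stone_basic a)"
      by simp
    then show ?case by blast
  qed
  then show thesis
    using that by blast
qed

text \<open>Ultrafilters separate elements: if \<open>a\<close> is not below \<open>b\<close>, the principal filter of
  \<open>a \<sqinter> - b\<close> is proper and extends to an ultrafilter containing \<open>a\<close> but not \<open>b\<close>. As a consequence,
  identities in the algebra can be verified ultrafilter by ultrafilter.\<close>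

lemma stone_basic_le_iff: "stone_basic a \<subseteq> stone_basic b \<longleftrightarrow> a \<le> b"
proof
  show "stone_basic a \<subseteq> stone_basic b" if "a \<le> b"
    using that by (auto simp: stone_basic_def dest: ultrafilterD(3))
next
  assume sub: "stone_basic a \<subseteq> stone_basic b"
  show "a \<le> b"
  proof (rule ccontr)
    assume "\<not> a \<le> b"
    then have "inf a (- b) \<noteq> bot"
      by (simp add: inf_shunt)
    then have "proper_filter {c. inf a (- b) \<le> c}"
      by (auto simp: proper_filter_def bot_unique intro: order_trans)
    then obtain U where U: "U \<in> ultrafilters" "inf a (- b) \<in> U"
      by (rule proper_filter_extends_to_ultrafilter) auto
    then show False
      using sub by (auto simp: stone_basic_def ultrafilterD(4) compl_mem_ultrafilter)
  qed
qed

lemma le_iff_ultrafilters: "a \<le> b \<longleftrightarrow> (\<forall>U\<in>ultrafilters. a \<in> U \<longrightarrow> b \<in> U)"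
  using stone_basic_le_iff[of a b] by (auto simp: stone_basic_def)

lemma eq_iff_ultrafilters: "a = b \<longleftrightarrow> (\<forall>U\<in>ultrafilters. a \<in> U \<longleftrightarrow> b \<in> U)"
  by (subst order.eq_iff) (auto simp: le_iff_ultrafilters)

lemma neq_bot_ultrafilter:
  assumes "a \<noteq> bot"
  obtains U where "U \<in> ultrafilters" "a \<in> U"
  using assms ultrafilterD(1) unfolding eq_iff_ultrafilters[of a] by blast

lemma openin_stone_basic: "openin stone_space (stone_basic a)"
  unfolding openin_stone_space by (rule union_of_inc) (auto simp: arbitrary_def)

lemma continuous_map_mem_ultrafilter:
  "continuous_map stone_space (discrete_topology UNIV) (\<lambda>U. a \<in> U)"
  unfolding continuous_map_discrete_iff
proof
  fix y
  have "{U \<in> topspace stone_space. (a \<in> U) = y} = stone_basic (if y then a else - a)"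
    by (auto simp: stone_basic_def compl_mem_ultrafilter)
  then show "openin stone_space {U \<in> topspace stone_space. (a \<in> U) = y}"
    using openin_stone_basic by metis
qed

lemma openin_stone_space_basic:
  assumes "openin stone_space W" "U \<in> W"
  obtains a where "U \<in> stone_basic a" "stone_basic a \<subseteq> W"
  using assms unfolding openin_stone_space by (fastforce simp: union_of_def arbitrary_def)

text \<open>Compactness. If no finite part of the cover suffices, the complements of the elements
  of \<open>A\<close> generate a proper filter; an ultrafilter extending it contains no element of \<open>A\<close>.\<close>

lemma stone_basic_finite_subcover:
  assumes cover: "ultrafilters \<subseteq> (\<Union>a::'a::boolean_algebra\<in>A. stone_basic a)"
  obtains A0 where "finite A0" "A0 \<subseteq> A" "ultrafilters = (\<Union>a\<in>A0. stone_basic a)"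
proof (rule ccontr)
  assume "\<not> thesis"
  then have no: "ultrafilters \<noteq> (\<Union>a\<in>A0. stone_basic a)" if "finite A0" "A0 \<subseteq> A" for A0
    using \<open>\<And>A0. finite A0 \<Longrightarrow> A0 \<subseteq> A \<Longrightarrow> ultrafilters = (\<Union>a\<in>A0. stone_basic a) \<Longrightarrow> thesis\<close> that
    by blast
  \<comment> \<open>The filter generated by the complements: \<open>b\<close> lies above the complement of a finite union.\<close>
  define F where "F = {b. \<exists>A0. finite A0 \<and> A0 \<subseteq> A \<and> ultrafilters \<subseteq> (\<Union>a\<in>A0. stone_basic a) \<union> stone_basic b}"
  have "proper_filter F"
    unfolding proper_filter_def
  proof (intro conjI ballI allI impI)
    have "ultrafilters \<subseteq> stone_basic (- bot :: 'a)"
      using ultrafilterD(2) unfolding stone_basic_def by blast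
    then have "- bot \<in> F"
      unfolding F_def by (intro CollectI exI[of _ "{}"]) blast
    then show "F \<noteq> {}"
      by blast
    show "bot \<notin> F"
    proof
      assume "bot \<in> F"
      moreover have "stone_basic (bot :: 'a) = {}"
        by (auto simp: stone_basic_def ultrafilterD(1))
      ultimately obtain A0 where "finite A0" "A0 \<subseteq> A" "ultrafilters \<subseteq> (\<Union>a\<in>A0. stone_basic a)"
        by (auto simp: F_def)
      moreover have "(\<Union>a\<in>A0. stone_basic a) \<subseteq> ultrafilters"
        by (auto simp: stone_basic_def)
      ultimately show False
        using no[of A0] by blast
    qed
  next
    fix a b assume "a \<in> F" "a \<le> b"
    then show "b \<in> F"
      unfolding F_def using stone_basic_le_iff[of a b] by blast
  next
    fix a b assume "a \<in> F" "b \<in> F"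
    then obtain A0 B0 where A0: "finite A0" "A0 \<subseteq> A" "ultrafilters \<subseteq> (\<Union>a\<in>A0. stone_basic a) \<union> stone_basic a"
      and B0: "finite B0" "B0 \<subseteq> A" "ultrafilters \<subseteq> (\<Union>a\<in>B0. stone_basic a) \<union> stone_basic b"
      by (auto simp: F_def)
    have "stone_basic (inf a b) = stone_basic a \<inter> stone_basic b"
      by (auto simp: stone_basic_def ultrafilterD(4))
    then have "ultrafilters \<subseteq> (\<Union>a\<in>A0 \<union> B0. stone_basic a) \<union> stone_basic (inf a b)"
      using A0(3) B0(3) by blast
    then show "inf a b \<in> F"
      unfolding F_def using A0 B0 by (intro CollectI exI[of _ "A0 \<union> B0"]) auto
  qed
  then obtain U where U: "U \<in> ultrafilters" "F \<subseteq> U"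
    by (rule proper_filter_extends_to_ultrafilter)
  then obtain a where a: "a \<in> A" "a \<in> U"
    using cover by (auto simp: stone_basic_def)
  have "- a \<in> F"
    unfolding F_def using a(1) by (intro CollectI exI[of _ "{a}"]) (auto simp: stone_basic_def compl_mem_ultrafilter)
  then show False
    using U a(2) compl_mem_ultrafilter[OF U(1), of a] by blast
qed

text \<open>The basic sets contained in \<open>C\<close> or disjoint from it cover the space; a finite subcover
  exhibits \<open>C\<close> as a finite union of basic sets, and such a union is basic again.\<close>

lemma stone_space_clopen_basic:
  assumes C: "openin stone_space C" and D: "openin stone_space (ultrafilters - C)"
  obtains c where "stone_basic c = C"
proof -
  let ?A = "{a. stone_basic a \<subseteq> C \<or> stone_basic a \<inter> C = {}}"
  have "ultrafilters \<subseteq> (\<Union>a\<in>?A. stone_basic a)"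
  proof
    fix U :: "'a set" assume U: "U \<in> ultrafilters"
    show "U \<in> (\<Union>a\<in>?A. stone_basic a)"
    proof (cases "U \<in> C")
      case True
      with C show ?thesis
        by (rule openin_stone_space_basic) auto
    next
      case False
      with U have "U \<in> ultrafilters - C"
        by blast
      with D show ?thesis
        by (rule openin_stone_space_basic) auto
    qed
  qed
  then obtain A0 where A0: "finite A0" "A0 \<subseteq> ?A" "ultrafilters = (\<Union>a\<in>A0. stone_basic a)"
    by (rule stone_basic_finite_subcover)
  have "finite {a \<in> A0. stone_basic a \<subseteq> C}"
    using A0(1) by simp
  then obtain c where c: "stone_basic c = (\<Union>a\<in>{a \<in> A0. stone_basic a \<subseteq> C}. stone_basic a)"
    by (rule stone_basic_Union)
  have "C \<subseteq> ultrafilters"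
    using openin_subset[OF C] by simp
  have "C \<subseteq> (\<Union>a\<in>{a \<in> A0. stone_basic a \<subseteq> C}. stone_basic a)"
  proof
    fix U assume "U \<in> C"
    then obtain a where "a \<in> A0" "U \<in> stone_basic a"
      using \<open>C \<subseteq> ultrafilters\<close> A0(3) by blast
    then have "stone_basic a \<subseteq> C"
      using A0(2) \<open>U \<in> C\<close> by blast
    then show "U \<in> (\<Union>a\<in>{a \<in> A0. stone_basic a \<subseteq> C}. stone_basic a)"
      using \<open>a \<in> A0\<close> \<open>U \<in> stone_basic a\<close> by blast
  qed
  with c have "stone_basic c = C"
    by blast
  then show thesis
    by (rule that)
qed

text \<open>This lets elements of the algebra be defined by their membership in ultrafilters, which is
  how all matrices below are constructed.\<close>

lemma stone_space_level_set_basic: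
  fixes f :: "'a::boolean_algebra set \<Rightarrow> 'b"
  assumes "continuous_map stone_space (discrete_topology UNIV) f"
  obtains c where "\<forall>U\<in>ultrafilters. c \<in> U \<longleftrightarrow> P (f U)"
proof -
  let ?C = "{U \<in> topspace stone_space. f U \<in> Collect P}"
  have "openin stone_space ?C"
    by (rule openin_continuous_map_preimage[OF assms]) simp
  moreover have "openin stone_space {U \<in> topspace stone_space. f U \<in> - Collect P}"
    by (rule openin_continuous_map_preimage[OF assms]) simp
  moreover have "{U \<in> topspace stone_space. f U \<in> - Collect P} = ultrafilters - ?C"
    by auto
  ultimately obtain c where c: "stone_basic c = ?C"
    using stone_space_clopen_basic[of ?C] by metis
  show thesis
  proof (rule that, rule ballI)
    show "c \<in> U \<longleftrightarrow> P (f U)" if "U \<in> ultrafilters" for U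
      using that arg_cong[OF c, of "\<lambda>S. U \<in> S"] by (simp add: stone_basic_def)
  qed
qed

text \<open>A finite subcover by basic sets, each contained in some \<open>W V\<close>, is listed, and \<open>\<sigma> U\<close> is the
  point \<open>V\<close> attached to the first set of the list that contains \<open>U\<close>. Being first in the list is a clopen
  condition, so \<open>\<sigma>\<close> is locally constant.\<close>

lemma stone_space_locally_constant_choice:
  fixes W :: "'a::boolean_algebra set \<Rightarrow> 'a set set"
  assumes W: "\<And>U. U \<in> ultrafilters \<Longrightarrow> openin stone_space (W U) \<and> U \<in> W U"
  obtains \<sigma> where "continuous_map stone_space (discrete_topology UNIV) \<sigma>"
    "finite (\<sigma> ` ultrafilters)" "\<forall>U\<in>ultrafilters. \<sigma> U \<in> ultrafilters \<and> U \<in> W (\<sigma> U)"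
proof -
  let ?A = "{a. \<exists>V\<in>ultrafilters. stone_basic a \<subseteq> W V}"
  have "ultrafilters \<subseteq> (\<Union>a\<in>?A. stone_basic a)"
  proof
    fix U :: "'a set" assume U: "U \<in> ultrafilters"
    then obtain a where "U \<in> stone_basic a" "stone_basic a \<subseteq> W U"
      using W openin_stone_space_basic by metis
    with U show "U \<in> (\<Union>a\<in>?A. stone_basic a)"
      by blast
  qed
  then obtain A0 where A0: "finite A0" "A0 \<subseteq> ?A" "ultrafilters = (\<Union>a\<in>A0. stone_basic a)"
    by (rule stone_basic_finite_subcover)
  from A0(1) obtain as where as: "set as = A0"
    using finite_list by blast
  obtain p where p: "\<And>a. a \<in> A0 \<Longrightarrow> p a \<in> ultrafilters \<and> stone_basic a \<subseteq> W (p a)"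
  proof -
    have "\<forall>a\<in>A0. \<exists>V. V \<in> ultrafilters \<and> stone_basic a \<subseteq> W V"
      using A0(2) by blast
    from bchoice[OF this] show thesis
      using that by blast
  qed
  \<comment> \<open>\<open>\<phi> as U\<close> is the first element of the list that belongs to \<open>U\<close>.\<close>
  define \<phi> where "\<phi> = (\<lambda>bs (U :: 'a set). find (\<lambda>a. a \<in> U) bs)"
  have cont: "continuous_map stone_space (discrete_topology UNIV) (\<phi> bs)" for bs
  proof (induction bs)
    case Nil
    then show ?case by (simp add: \<phi>_def)
  next
    case (Cons a bs)
    have "continuous_map stone_space (discrete_topology UNIV)
        (\<lambda>U. (\<lambda>q r. if q then Some a else r) (a \<in> U) (\<phi> bs U))"
      using continuous_map_mem_ultrafilter Cons by (rule continuous_map_discrete_comp2)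
    moreover have "(\<lambda>U. (\<lambda>q r. if q then Some a else r) (a \<in> U) (\<phi> bs U)) = \<phi> (a # bs)"
      by (auto simp: \<phi>_def fun_eq_iff)
    ultimately show ?case by simp
  qed
  have found: "\<exists>a\<in>A0. \<phi> as U = Some a \<and> a \<in> U" if U: "U \<in> ultrafilters" for U
  proof -
    obtain b where "b \<in> set as" "b \<in> U"
      using U A0(3) as by (auto simp: stone_basic_def)
    then have "\<phi> as U \<noteq> None"
      by (auto simp: \<phi>_def find_None_iff)
    then obtain a where "\<phi> as U = Some a"
      by blast
    then show ?thesis
      using as by (auto simp: \<phi>_def find_Some_iff)
  qed
  define \<sigma> where "\<sigma> = (\<lambda>U. p (the (\<phi> as U)))"
  have "continuous_map stone_space (discrete_topology UNIV) \<sigma>"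
    using continuous_map_discrete_comp2[OF cont cont, of "\<lambda>q _. p (the q)" as as]
    by (simp add: \<sigma>_def)
  moreover have "\<sigma> ` ultrafilters \<subseteq> p ` A0"
    using found by (force simp: \<sigma>_def)
  then have "finite (\<sigma> ` ultrafilters)"
    using A0(1) finite_surj by blast
  moreover have "\<sigma> U \<in> ultrafilters \<and> U \<in> W (\<sigma> U)" if U: "U \<in> ultrafilters" for U
  proof -
    obtain a where "a \<in> A0" "\<phi> as U = Some a" "a \<in> U"
      using found[OF U] by blast
    then show ?thesis
      using p[of a] U by (auto simp: stone_basic_def \<sigma>_def)
  qed
  ultimately show thesis
    by (intro that ballI)
qed

lemma stone_space_rank_bounded:
  fixes f :: "'a::boolean_algebra set \<Rightarrow> nat"
  assumes f: "continuous_map stone_space (discrete_topology UNIV) f"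
  obtains n where "\<forall>U\<in>ultrafilters. f U < n"
proof -
  define W where "W = (\<lambda>U. {V \<in> topspace stone_space. f V = f U})"
  have W: "openin stone_space (W U) \<and> U \<in> W U" if "U \<in> ultrafilters" for U
    using f that unfolding continuous_map_discrete_iff W_def by simp
  obtain \<sigma> where "continuous_map stone_space (discrete_topology UNIV) \<sigma>"
    and fin: "finite (\<sigma> ` ultrafilters)"
    and \<sigma>: "\<forall>U\<in>ultrafilters. \<sigma> U \<in> ultrafilters \<and> U \<in> W (\<sigma> U)"
    by (rule stone_space_locally_constant_choice[of W, OF W])
  have "f ` ultrafilters \<subseteq> f ` \<sigma> ` ultrafilters"
    using \<sigma> by (force simp: W_def)
  with fin have "finite (f ` ultrafilters)"
    using finite_subset by blast
  then obtain n where "\<forall>k\<in>f ` ultrafilters. k < n"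
    using finite_nat_set_iff_bounded by blast
  with that show thesis by blast
qed

section \<open>Matrices over a Boolean algebra and their idempotents\<close>

text \<open>Primeness of ultrafilters, for the abstract join that occurs in the matrix product.\<close>

lemma sjoin_boolean_finite:
  fixes Y :: "'a::boolean_algebra set"
  assumes Y: "finite Y" and U: "U \<in> ultrafilters"
  shows "sjoin boolean_semigroup Y \<in> U \<longleftrightarrow> (\<exists>y\<in>Y. y \<in> U)"
proof -
  obtain b where b: "stone_basic b = (\<Union>y\<in>Y. stone_basic y)"
    using stone_basic_Union[OF Y] .
  have le: "b \<le> k \<longleftrightarrow> (\<forall>y\<in>Y. y \<le> k)" for k
    using UN_subset_iff[of stone_basic Y "stone_basic k"]
    unfolding b[symmetric] stone_basic_le_iff .
  have "is_sjoin boolean_semigroup Y j \<longleftrightarrow> j = b" for j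
    using le[of b] le[of j] le
    by (auto simp: is_sjoin_def intro: order.antisym)
  then have "sjoin boolean_semigroup Y = b"
    by (simp add: sjoin_def)
  moreover have "b \<in> U \<longleftrightarrow> (\<exists>y\<in>Y. y \<in> U)"
    using b U by (auto simp: stone_basic_def set_eq_iff)
  ultimately show ?thesis by simp
qed

abbreviation boolean_matrices :: "(nat \<Rightarrow> nat \<Rightarrow> 'a::boolean_algebra) semigrp" where
  "boolean_matrices \<equiv> rook_matrices boolean_semigroup"

text \<open>The orthogonality conditions on rows and columns say that the relation
  \<open>{(i, j). A i j \<in> U}\<close> is a partial bijection for every ultrafilter \<open>U\<close>.\<close>

lemma boolean_matrix_iff:
  fixes A :: "nat \<Rightarrow> nat \<Rightarrow> 'a::boolean_algebra"
  shows "A \<in> carrier boolean_matrices \<longleftrightarrow>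
    finite {(i, j). A i j \<noteq> bot} \<and>
    (\<forall>U\<in>ultrafilters. \<forall>i j k. A i j \<in> U \<longrightarrow> A i k \<in> U \<longrightarrow> j = k) \<and>
    (\<forall>U\<in>ultrafilters. \<forall>i j k. A i k \<in> U \<longrightarrow> A j k \<in> U \<longrightarrow> i = j)"
proof -
  have "inf a b = bot \<longleftrightarrow> (\<forall>U\<in>ultrafilters. a \<in> U \<longrightarrow> b \<notin> U)" for a b :: 'a
    by (auto simp: eq_iff_ultrafilters[of "inf a b"] ultrafilterD)
  then have "A \<in> carrier boolean_matrices \<longleftrightarrow> finite {(i, j). A i j \<noteq> bot} \<and>
      (\<forall>i j k. j \<noteq> k \<longrightarrow> (\<forall>U\<in>ultrafilters. A i j \<in> U \<longrightarrow> A i k \<notin> U)) \<and>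
      (\<forall>i j k. i \<noteq> j \<longrightarrow> (\<forall>U\<in>ultrafilters. A i k \<in> U \<longrightarrow> A j k \<notin> U))"
    by (simp add: rook_matrices_def)
  then show ?thesis
    by metis
qed

lemma boolean_matrix_unique:
  assumes "A \<in> carrier boolean_matrices" "U \<in> ultrafilters"
  shows "A i j \<in> U \<Longrightarrow> A i k \<in> U \<Longrightarrow> j = k" "A i k \<in> U \<Longrightarrow> A j k \<in> U \<Longrightarrow> i = j"
  using assms unfolding boolean_matrix_iff by blast+

lemma boolean_matrix_eqI:
  fixes A B :: "nat \<Rightarrow> nat \<Rightarrow> 'a::boolean_algebra"
  assumes "\<And>U i j. U \<in> ultrafilters \<Longrightarrow> A i j \<in> U \<longleftrightarrow> B i j \<in> U"
  shows "A = B"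
  using assms by (auto simp: fun_eq_iff eq_iff_ultrafilters[of "A _ _"])

text \<open>At each ultrafilter the product of matrices is the composition of relations. The finite
  support of \<open>B\<close> makes the join in the definition of the product finite.\<close>

lemma mem_boolean_matrix_mult:
  assumes B: "B \<in> carrier boolean_matrices" and U: "U \<in> ultrafilters"
  shows "(A \<star>\<^bsub>boolean_matrices\<^esub> B) i j \<in> U \<longleftrightarrow> (\<exists>k. A i k \<in> U \<and> B k j \<in> U)"
proof -
  have "finite {(i, j). B i j \<noteq> bot}"
    using B by (simp add: boolean_matrix_iff)
  then have "finite (insert bot ((\<lambda>(k, l). inf (A i k) (B k j)) ` {(i, j). B i j \<noteq> bot}))"
    by blast
  moreover have "{inf (A i k) (B k j) | k. True} \<subseteq> \<dots>"
    by (auto simp: image_iff) (metis inf_bot_right)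
  ultimately have "finite {inf (A i k) (B k j) | k. True}"
    by (rule finite_subset[rotated])
  then show ?thesis
    using sjoin_boolean_finite[OF _ U, of "{inf (A i k) (B k j) | k. True}"]
    by (auto simp: rook_matrices_def ultrafilterD(4)[OF U])
qed

lemma boolean_matrix_transpose:
  assumes A: "A \<in> carrier boolean_matrices"
  shows "(\<lambda>i j. A j i) \<in> carrier boolean_matrices"
proof -
  have "{(i, j). A j i \<noteq> bot} = prod.swap ` {(i, j). A i j \<noteq> bot}"
    by auto
  then show ?thesis
    using A unfolding boolean_matrix_iff by simp
qed

text \<open>At each ultrafilter the transpose is the converse relation, and a partial bijection
  determines its generalized inverse among partial bijections uniquely.\<close>

lemma sinv_boolean_matrix:
  assumes A: "A \<in> carrier boolean_matrices"
  shows "sinv boolean_matrices A = (\<lambda>i j. A j i)"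
proof -
  let ?M = "boolean_matrices :: (nat \<Rightarrow> nat \<Rightarrow> 'a) semigrp"
  let ?T = "\<lambda>i j. A j i"
  note T = boolean_matrix_transpose[OF A]
  have "is_sinverse ?M A ?T"
    unfolding is_sinverse_def
  proof (intro conjI T)
    show "A \<star>\<^bsub>?M\<^esub> ?T \<star>\<^bsub>?M\<^esub> A = A"
      by (rule boolean_matrix_eqI)
        (use boolean_matrix_unique[OF A] in \<open>auto simp: mem_boolean_matrix_mult A T\<close>)
    show "?T \<star>\<^bsub>?M\<^esub> A \<star>\<^bsub>?M\<^esub> ?T = ?T"
      by (rule boolean_matrix_eqI)
        (use boolean_matrix_unique[OF A] in \<open>auto simp: mem_boolean_matrix_mult A T\<close>)
  qed
  moreover have "B = ?T" if B: "is_sinverse ?M A B" for B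
  proof (rule boolean_matrix_eqI)
    fix U :: "'a set" and i j assume U: "U \<in> ultrafilters"
    have Bc: "B \<in> carrier ?M" and ABA: "A \<star>\<^bsub>?M\<^esub> B \<star>\<^bsub>?M\<^esub> A = A" and BAB: "B \<star>\<^bsub>?M\<^esub> A \<star>\<^bsub>?M\<^esub> B = B"
      using B by (auto simp: is_sinverse_def)
    have a: "(\<exists>l k. A p k \<in> U \<and> B k l \<in> U \<and> A l q \<in> U) \<longleftrightarrow> A p q \<in> U" for p q
      using arg_cong[OF ABA, of "\<lambda>A. A p q \<in> U"] by (auto simp: mem_boolean_matrix_mult A Bc U)
    have b: "(\<exists>l k. B p k \<in> U \<and> A k l \<in> U \<and> B l q \<in> U) \<longleftrightarrow> B p q \<in> U" for p q
      using arg_cong[OF BAB, of "\<lambda>A. A p q \<in> U"] by (auto simp: mem_boolean_matrix_mult A Bc U)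
    show "B i j \<in> U \<longleftrightarrow> A j i \<in> U"
      using a[of j i] b[of i j] boolean_matrix_unique[OF A U] boolean_matrix_unique[OF Bc U] by metis
  qed
  ultimately show ?thesis
    unfolding sinv_def by (rule the_equality)
qed

lemma zero_boolean_matrix: "(\<lambda>i j. bot) \<in> carrier boolean_matrices"
  by (simp add: boolean_matrix_iff ultrafilterD)

lemma szero_boolean_matrices: "szero boolean_matrices = (\<lambda>i j. bot :: 'a::boolean_algebra)"
  unfolding szero_def
proof (rule the_equality)
  let ?M = "boolean_matrices :: (nat \<Rightarrow> nat \<Rightarrow> 'a) semigrp"
  let ?O = "\<lambda>i j. bot :: 'a"
  have l: "?O \<star>\<^bsub>?M\<^esub> A = ?O" "A \<star>\<^bsub>?M\<^esub> ?O = ?O" if "A \<in> carrier ?M" for A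
    by (rule boolean_matrix_eqI;
        simp add: mem_boolean_matrix_mult that zero_boolean_matrix ultrafilterD)+
  then show "is_szero ?M ?O"
    by (simp add: is_szero_def zero_boolean_matrix)
  show "z = ?O" if "is_szero ?M z" for z
    using that l(2)[of z] zero_boolean_matrix unfolding is_szero_def by metis
qed

text \<open>A partial bijection that is idempotent under composition is the identity of its domain.\<close>

lemma idempotent_boolean_matrix_iff:
  fixes E :: "nat \<Rightarrow> nat \<Rightarrow> 'a::boolean_algebra"
  shows
  "E \<in> idempotents boolean_matrices \<longleftrightarrow>
    E \<in> carrier boolean_matrices \<and> (\<forall>U\<in>ultrafilters. \<forall>i j. E i j \<in> U \<longrightarrow> i = j)"
  (is "?L \<longleftrightarrow> ?R")
proof
  assume L: ?L
  then have E: "E \<in> carrier boolean_matrices" and EE: "E \<star>\<^bsub>boolean_matrices\<^esub> E = E"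
    by (auto simp: idempotents_def)
  have "i = j" if U: "U \<in> ultrafilters" and ij: "E i j \<in> U" for U i j
  proof -
    have "(E \<star>\<^bsub>boolean_matrices\<^esub> E) i j \<in> U"
      using ij EE by simp
    then obtain k where "E i k \<in> U" "E k j \<in> U"
      by (auto simp: mem_boolean_matrix_mult[OF E U])
    then show ?thesis
      using ij boolean_matrix_unique[OF E U] by metis
  qed
  with E show ?R by blast
next
  assume R: ?R
  have "E \<star>\<^bsub>boolean_matrices\<^esub> E = E"
  proof (rule boolean_matrix_eqI)
    fix U :: "'a set" and i j assume U: "U \<in> ultrafilters"
    show "(E \<star>\<^bsub>boolean_matrices\<^esub> E) i j \<in> U \<longleftrightarrow> E i j \<in> U"
      using R U by (auto simp: mem_boolean_matrix_mult)
  qed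
  with R show ?L
    by (auto simp: idempotents_def)
qed

lemma idempotent_boolean_matrixI:
  assumes fin: "finite {(i, j). E i j \<noteq> bot}"
    and diag: "\<And>U i j. U \<in> ultrafilters \<Longrightarrow> E i j \<in> U \<Longrightarrow> i = j"
  shows "E \<in> idempotents boolean_matrices"
proof -
  have "E \<in> carrier boolean_matrices"
    unfolding boolean_matrix_iff
  proof (intro conjI ballI allI impI)
    show "j = k" if "U \<in> ultrafilters" "E i j \<in> U" "E i k \<in> U" for U i j k
      using diag[OF that(1,2)] diag[OF that(1,3)] by simp
    show "i = j" if "U \<in> ultrafilters" "E i k \<in> U" "E j k \<in> U" for U i j k
      using diag[OF that(1,2)] diag[OF that(1,3)] by simp
  qed (rule fin)
  then show ?thesis
    using diag by (simp add: idempotent_boolean_matrix_iff)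
qed

text \<open>The natural order is inclusion of relations at each ultrafilter: if \<open>A\<close> is contained in
  \<open>B\<close>, then \<open>A\<close> is \<open>B\<close> multiplied by the idempotent \<open>A\<^sup>-\<^sup>1A\<close>, the identity of the range of \<open>A\<close>.\<close>

lemma sle_boolean_matrix_iff:
  fixes A B :: "nat \<Rightarrow> nat \<Rightarrow> 'a::boolean_algebra"
  assumes A: "A \<in> carrier boolean_matrices" and B: "B \<in> carrier boolean_matrices"
  shows "sle boolean_matrices A B \<longleftrightarrow> (\<forall>U\<in>ultrafilters. \<forall>i j. A i j \<in> U \<longrightarrow> B i j \<in> U)"
proof
  assume "sle boolean_matrices A B"
  then obtain E where E: "E \<in> idempotents boolean_matrices" "A = B \<star>\<^bsub>boolean_matrices\<^esub> E"
    by (auto simp: sle_def)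
  then show "\<forall>U\<in>ultrafilters. \<forall>i j. A i j \<in> U \<longrightarrow> B i j \<in> U"
    by (auto simp: idempotent_boolean_matrix_iff mem_boolean_matrix_mult)
next
  assume sub: "\<forall>U\<in>ultrafilters. \<forall>i j. A i j \<in> U \<longrightarrow> B i j \<in> U"
  let ?T = "\<lambda>i j. A j i"
  let ?E = "?T \<star>\<^bsub>boolean_matrices\<^esub> A"
  have memE: "?E i j \<in> U \<longleftrightarrow> i = j \<and> (\<exists>k. A k i \<in> U)" if "U \<in> ultrafilters" for U i j
    using boolean_matrix_unique[OF A that] by (auto simp: mem_boolean_matrix_mult[OF A that])
  have "{(i, j). ?E i j \<noteq> bot} \<subseteq> (\<lambda>(k, i). (i, i)) ` {(i, j). A i j \<noteq> bot}"
  proof clarify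
    fix i j assume "?E i j \<noteq> bot"
    then obtain U where "U \<in> ultrafilters" "?E i j \<in> U"
      by (rule neq_bot_ultrafilter)
    then obtain k where "i = j" "A k i \<noteq> bot"
      using memE ultrafilterD(1) by metis
    then show "(i, j) \<in> (\<lambda>(k, i). (i, i)) ` {(i, j). A i j \<noteq> bot}"
      by force
  qed
  moreover have "finite {(i, j). A i j \<noteq> bot}"
    using A by (simp add: boolean_matrix_iff)
  ultimately have "finite {(i, j). ?E i j \<noteq> bot}"
    using finite_surj by blast
  then have E: "?E \<in> idempotents boolean_matrices"
    by (rule idempotent_boolean_matrixI) (simp add: memE)
  then have Ec: "?E \<in> carrier boolean_matrices"
    by (simp add: idempotents_def)
  have "A = B \<star>\<^bsub>boolean_matrices\<^esub> ?E"
  proof (rule boolean_matrix_eqI)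
    fix U :: "'a set" and i j assume U: "U \<in> ultrafilters"
    have "A i j \<in> U \<longleftrightarrow> B i j \<in> U \<and> (\<exists>l. A l j \<in> U)"
      using sub U boolean_matrix_unique(2)[OF B U] by metis
    then show "A i j \<in> U \<longleftrightarrow> (B \<star>\<^bsub>boolean_matrices\<^esub> ?E) i j \<in> U"
      by (simp add: mem_boolean_matrix_mult[OF Ec U] memE[OF U] conj_commute)
  qed
  with E show "sle boolean_matrices A B"
    by (auto simp: sle_def)
qed

lemma sjoin_idempotent_boolean_matrices:
  assumes E: "E \<in> idempotents boolean_matrices" and F: "F \<in> idempotents boolean_matrices"
  shows "sjoin boolean_matrices {E, F} = (\<lambda>i j. sup (E i j) (F i j))" (is "_ = ?J")
    and "(\<lambda>i j. sup (E i j) (F i j)) \<in> idempotents boolean_matrices"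
proof -
  have diag: "E i j \<in> U \<Longrightarrow> i = j" "F i j \<in> U \<Longrightarrow> i = j" if "U \<in> ultrafilters" for U i j
    using E F that by (auto simp: idempotent_boolean_matrix_iff)
  have Ec: "E \<in> carrier boolean_matrices" and Fc: "F \<in> carrier boolean_matrices"
    using E F by (auto simp: idempotents_def)
  have "{(i, j). sup (E i j) (F i j) \<noteq> bot} = {(i, j). E i j \<noteq> bot} \<union> {(i, j). F i j \<noteq> bot}"
    by auto
  then have "finite {(i, j). sup (E i j) (F i j) \<noteq> bot}"
    using Ec Fc by (simp add: boolean_matrix_iff)
  then show J: "?J \<in> idempotents boolean_matrices"
  proof (rule idempotent_boolean_matrixI)
    show "i = j" if "U \<in> ultrafilters" "sup (E i j) (F i j) \<in> U" for U i j
      using that diag[OF that(1), of i j] by (auto simp: sup_mem_ultrafilter)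
  qed
  then have Jc: "?J \<in> carrier boolean_matrices"
    by (simp add: idempotents_def)
  have le: "sle boolean_matrices ?J K \<longleftrightarrow> sle boolean_matrices E K \<and> sle boolean_matrices F K"
    if "K \<in> carrier boolean_matrices" for K
    using that by (auto simp: sle_boolean_matrix_iff Ec Fc Jc sup_mem_ultrafilter)
  have refl: "sle boolean_matrices K K" if "K \<in> carrier boolean_matrices" for K :: "nat \<Rightarrow> nat \<Rightarrow> 'a"
    using that by (simp add: sle_boolean_matrix_iff)
  show "sjoin boolean_matrices {E, F} = ?J"
    unfolding sjoin_def
  proof (rule the_equality)
    show "is_sjoin boolean_matrices {E, F} ?J"
      using le Jc refl by (auto simp: is_sjoin_def)
    show "K = ?J" if K: "is_sjoin boolean_matrices {E, F} K" for K
    proof -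
      have Kc: "K \<in> carrier boolean_matrices"
        using K by (simp add: is_sjoin_def)
      have "sle boolean_matrices K ?J" "sle boolean_matrices ?J K"
        using K le[OF Kc] le[OF Jc] refl[OF Jc] Jc by (auto simp: is_sjoin_def)
      then show ?thesis
        by (intro boolean_matrix_eqI) (auto simp: sle_boolean_matrix_iff Kc Jc)
    qed
  qed
qed

lemma finite_boolean_matrix_diagonal:
  assumes A: "A \<in> carrier boolean_matrices"
  shows "finite {i. A i i \<noteq> bot}"
proof -
  have "{i. A i i \<noteq> bot} \<subseteq> fst ` {(i, j). A i j \<noteq> bot}"
    by force
  moreover have "finite {(i, j). A i j \<noteq> bot}"
    using A by (simp add: boolean_matrix_iff)
  ultimately show ?thesis
    by (rule finite_surj[rotated])
qed

lemma finite_boolean_matrix_rank_set: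
  assumes A: "A \<in> carrier boolean_matrices" and U: "U \<in> ultrafilters"
  shows "finite {i. A i i \<in> U}"
  by (rule finite_subset[OF _ finite_boolean_matrix_diagonal[OF A]]) (use ultrafilterD(1)[OF U] in auto)

text \<open>Only finitely many diagonal entries are non-zero, and membership of each one in \<open>U\<close> is a
  clopen condition.\<close>

lemma continuous_map_boolean_matrix_diagonal:
  assumes A: "A \<in> carrier boolean_matrices"
  shows "continuous_map stone_space (discrete_topology UNIV) (\<lambda>U. {i. A i i \<in> U})"
proof -
  have *: "continuous_map stone_space (discrete_topology UNIV) (\<lambda>U. {i. i < n \<and> A i i \<in> U})" for n
  proof (induction n)
    case 0
    then show ?case by simp
  next
    case (Suc n)
    have "continuous_map stone_space (discrete_topology UNIV)
        (\<lambda>U. (\<lambda>q I. if q then insert n I else I) (A n n \<in> U) {i. i < n \<and> A i i \<in> U})"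
      using continuous_map_mem_ultrafilter Suc by (rule continuous_map_discrete_comp2)
    moreover have "(\<lambda>U. (\<lambda>q I. if q then insert n I else I) (A n n \<in> U) {i. i < n \<and> A i i \<in> U}) =
        (\<lambda>U. {i. i < Suc n \<and> A i i \<in> U})"
      by (auto simp: fun_eq_iff less_Suc_eq)
    ultimately show ?case by simp
  qed
  obtain n where n: "\<forall>i\<in>{i. A i i \<noteq> bot}. i < n"
    using finite_boolean_matrix_diagonal[OF A] finite_nat_set_iff_bounded by blast
  show ?thesis
  proof (rule continuous_map_eq[OF *[of n]])
    fix U :: "'a set" assume "U \<in> topspace stone_space"
    then show "{i. i < n \<and> A i i \<in> U} = {i. A i i \<in> U}"
      using n ultrafilterD(1)[of U] by auto metis
  qed
qed

text \<open>The order-preserving enumeration of a finite set of naturals. It supplies a canonical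
  bijection between two such sets of equal size, depending on nothing but the sets.\<close>

lemma bij_betw_card_less:
  fixes D :: "nat set"
  assumes D: "finite D"
  shows "bij_betw (\<lambda>i. card {x \<in> D. x < i}) D {..<card D}"
proof -
  let ?c = "\<lambda>i. card {x \<in> D. x < i}"
  have mono: "?c i < ?c j" if "i \<in> D" "i < j" for i j
  proof (rule psubset_card_mono)
    have "i \<in> {x \<in> D. x < j}" "i \<notin> {x \<in> D. x < i}"
      using that by simp_all
    then have "{x \<in> D. x < i} \<noteq> {x \<in> D. x < j}"
      by metis
    moreover have "{x \<in> D. x < i} \<subseteq> {x \<in> D. x < j}"
      using that by auto
    ultimately show "{x \<in> D. x < i} \<subset> {x \<in> D. x < j}"
      by (intro psubsetI)
  qed (use D in simp)
  have inj: "inj_on ?c D"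
  proof (rule inj_onI)
    fix i j assume ij: "i \<in> D" "j \<in> D" "?c i = ?c j"
    show "i = j"
      using mono[OF ij(1), of j] mono[OF ij(2), of i] ij(3) by (cases i j rule: linorder_cases) simp_all
  qed
  have sub: "?c ` D \<subseteq> {..<card D}"
  proof (rule image_subsetI)
    fix i assume "i \<in> D"
    then have "{x \<in> D. x < i} \<subset> D"
      by blast
    then show "?c i \<in> {..<card D}"
      using psubset_card_mono[OF D] by simp
  qed
  have "?c ` D = {..<card D}"
    using sub inj by (intro card_subset_eq) (simp_all add: card_image)
  with inj show ?thesis
    by (simp add: bij_betw_def)
qed

text \<open>Domain and range of a partial bijection have the same size; conversely, subsets of equal
  size are matched in increasing order. The matching at \<open>U\<close> depends only on the two diagonals at \<open>U\<close>,
  which are locally constant, so it is given by a matrix.\<close>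

lemma green_D_boolean_matrices_iff:
  fixes E F :: "nat \<Rightarrow> nat \<Rightarrow> 'a::boolean_algebra"
  assumes E: "E \<in> idempotents boolean_matrices" and F: "F \<in> idempotents boolean_matrices"
  shows "green_D boolean_matrices E F \<longleftrightarrow>
    (\<forall>U\<in>ultrafilters. card {i. E i i \<in> U} = card {i. F i i \<in> U})"
proof
  have diag: "E i j \<in> U \<Longrightarrow> i = j" "F i j \<in> U \<Longrightarrow> i = j" if "U \<in> ultrafilters" for U i j
    using E F that by (auto simp: idempotent_boolean_matrix_iff)
  have Ec: "E \<in> carrier boolean_matrices" and Fc: "F \<in> carrier boolean_matrices"
    using E F by (auto simp: idempotents_def)
  {
    assume "green_D boolean_matrices E F"
    then obtain A where A: "A \<in> carrier boolean_matrices"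
      and AE: "(\<lambda>i j. A j i) \<star>\<^bsub>boolean_matrices\<^esub> A = E"
      and AF: "A \<star>\<^bsub>boolean_matrices\<^esub> (\<lambda>i j. A j i) = F"
      by (auto simp: green_D_def sinv_boolean_matrix)
    show "\<forall>U\<in>ultrafilters. card {i. E i i \<in> U} = card {i. F i i \<in> U}"
    proof
      fix U :: "'a set" assume U: "U \<in> ultrafilters"
      let ?R = "{(i, j). A i j \<in> U}"
      have "{i. E i i \<in> U} = snd ` ?R"
        using mem_boolean_matrix_mult[OF A U] by (force simp flip: AE)
      moreover have "{i. F i i \<in> U} = fst ` ?R"
        using mem_boolean_matrix_mult[OF boolean_matrix_transpose[OF A] U] by (force simp flip: AF)
      moreover have "inj_on snd ?R" "inj_on fst ?R"
        using boolean_matrix_unique[OF A U] by (auto simp: inj_on_def)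
      ultimately show "card {i. E i i \<in> U} = card {i. F i i \<in> U}"
        by (simp add: card_image)
    qed
  next
    assume card: "\<forall>U\<in>ultrafilters. card {i. E i i \<in> U} = card {i. F i i \<in> U}"
    \<comment> \<open>\<open>c I i\<close> is the position of \<open>i\<close> in \<open>I\<close>, and \<open>P\<close> says that positions agree.\<close>
    define c where "c = (\<lambda>(I :: nat set) i. card {x \<in> I. x < i})"
    define P where "P = (\<lambda>(I, J) i j. i \<in> I \<and> j \<in> J \<and> c I i = c J j)"
    have cont: "continuous_map stone_space (discrete_topology UNIV) (\<lambda>U. ({i. F i i \<in> U}, {j. E j j \<in> U}))"
      using continuous_map_boolean_matrix_diagonal[OF Fc] continuous_map_boolean_matrix_diagonal[OF Ec]
      by (rule continuous_map_discrete_comp2)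
    have ex: "\<exists>a. \<forall>U\<in>ultrafilters. a \<in> U \<longleftrightarrow> P ({i. F i i \<in> U}, {j. E j j \<in> U}) i j" for i j
    proof -
      obtain a where "\<forall>U\<in>ultrafilters. a \<in> U \<longleftrightarrow> P ({i. F i i \<in> U}, {j. E j j \<in> U}) i j"
        using cont by (rule stone_space_level_set_basic[where P = "\<lambda>IJ. P IJ i j"])
      then show ?thesis ..
    qed
    define A where "A = (\<lambda>i j. SOME a. \<forall>U\<in>ultrafilters. a \<in> U \<longleftrightarrow> P ({i. F i i \<in> U}, {j. E j j \<in> U}) i j)"
    have "\<forall>U\<in>ultrafilters. A i j \<in> U \<longleftrightarrow> P ({i. F i i \<in> U}, {j. E j j \<in> U}) i j" for i j
      unfolding A_def by (rule someI_ex[OF ex])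
    then have memA: "A i j \<in> U \<longleftrightarrow> F i i \<in> U \<and> E j j \<in> U \<and> c {i. F i i \<in> U} i = c {j. E j j \<in> U} j"
      if "U \<in> ultrafilters" for U i j
      using that by (simp add: P_def)
    have bijE: "bij_betw (c {j. E j j \<in> U}) {j. E j j \<in> U} {..<card {j. E j j \<in> U}}"
      and bijF: "bij_betw (c {j. F j j \<in> U}) {j. F j j \<in> U} {..<card {j. F j j \<in> U}}"
      if "U \<in> ultrafilters" for U
      unfolding c_def using bij_betw_card_less[OF finite_boolean_matrix_rank_set[OF Ec that]]
        bij_betw_card_less[OF finite_boolean_matrix_rank_set[OF Fc that]] by simp_all
    have injE: "c {j. E j j \<in> U} i = c {j. E j j \<in> U} k \<Longrightarrow> E i i \<in> U \<Longrightarrow> E k k \<in> U \<Longrightarrow> i = k"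
      and injF: "c {j. F j j \<in> U} i = c {j. F j j \<in> U} k \<Longrightarrow> F i i \<in> U \<Longrightarrow> F k k \<in> U \<Longrightarrow> i = k"
      if "U \<in> ultrafilters" for U i k
      using bijE[OF that] bijF[OF that] by (auto simp: bij_betw_def inj_on_def)
    have img: "c {j. E j j \<in> U} ` {j. E j j \<in> U} = c {j. F j j \<in> U} ` {j. F j j \<in> U}"
      if "U \<in> ultrafilters" for U
      using bijE[OF that] bijF[OF that] card that by (simp add: bij_betw_def)
    have exE: "\<exists>j. A i j \<in> U" if U: "U \<in> ultrafilters" and i: "F i i \<in> U" for U i
    proof -
      have "c {j. F j j \<in> U} i \<in> c {j. E j j \<in> U} ` {j. E j j \<in> U}"
        unfolding img[OF U] using i by (intro imageI) simp
      then obtain j where "E j j \<in> U" "c {j. F j j \<in> U} i = c {j. E j j \<in> U} j"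
        by (elim imageE) simp
      then show ?thesis
        using memA[OF U] i by blast
    qed
    have exF: "\<exists>i. A i j \<in> U" if U: "U \<in> ultrafilters" and j: "E j j \<in> U" for U j
    proof -
      have "c {j. E j j \<in> U} j \<in> c {j. F j j \<in> U} ` {j. F j j \<in> U}"
        unfolding img[OF U, symmetric] using j by (intro imageI) simp
      then obtain i where "F i i \<in> U" "c {j. E j j \<in> U} j = c {j. F j j \<in> U} i"
        by (elim imageE) simp
      then show ?thesis
        using memA[OF U, of i j] j by auto
    qed
    have "{(i, j). A i j \<noteq> bot} \<subseteq> {i. F i i \<noteq> bot} \<times> {j. E j j \<noteq> bot}"
    proof clarify
      fix i j assume "A i j \<noteq> bot"
      then obtain U where U: "U \<in> ultrafilters" "A i j \<in> U"
        by (rule neq_bot_ultrafilter)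
      then show "i \<in> {i. F i i \<noteq> bot} \<and> j \<in> {j. E j j \<noteq> bot}"
        using memA[OF U(1)] ultrafilterD(1)[OF U(1)] by auto
    qed
    then have "finite {(i, j). A i j \<noteq> bot}"
      using finite_boolean_matrix_diagonal[OF Ec] finite_boolean_matrix_diagonal[OF Fc]
      by (meson finite_SigmaI finite_subset)
    then have A: "A \<in> carrier boolean_matrices"
      unfolding boolean_matrix_iff
    proof (intro conjI ballI allI impI)
      show "j = k" if "U \<in> ultrafilters" "A i j \<in> U" "A i k \<in> U" for U i j k
      proof -
        note j = memA[OF that(1), THEN iffD1, OF that(2)] and k = memA[OF that(1), THEN iffD1, OF that(3)]
        have "c {j. E j j \<in> U} j = c {j. E j j \<in> U} k"
          using j[THEN conjunct2, THEN conjunct2] k[THEN conjunct2, THEN conjunct2] by (rule trans[OF sym])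
        then show ?thesis
          using j[THEN conjunct2, THEN conjunct1] k[THEN conjunct2, THEN conjunct1]
          by (rule injE[OF that(1)])
      qed
      show "i = j" if "U \<in> ultrafilters" "A i k \<in> U" "A j k \<in> U" for U i j k
      proof -
        note i = memA[OF that(1), THEN iffD1, OF that(2)] and j = memA[OF that(1), THEN iffD1, OF that(3)]
        have "c {j. F j j \<in> U} i = c {j. F j j \<in> U} j"
          using i[THEN conjunct2, THEN conjunct2] j[THEN conjunct2, THEN conjunct2] by (rule trans[OF _ sym])
        then show ?thesis
          using i[THEN conjunct1] j[THEN conjunct1] by (rule injF[OF that(1)])
      qed
    qed
    have "(\<lambda>i j. A j i) \<star>\<^bsub>boolean_matrices\<^esub> A = E"
    proof (rule boolean_matrix_eqI)
      fix U :: "'a set" and i j assume U: "U \<in> ultrafilters"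
      have "(\<exists>k. A k i \<in> U \<and> A k j \<in> U) \<longleftrightarrow> i = j \<and> E i i \<in> U"
        using boolean_matrix_unique(1)[OF A U] exF[OF U] memA[OF U] by metis
      also have "\<dots> \<longleftrightarrow> E i j \<in> U"
        using diag(1)[OF U] by metis
      finally show "((\<lambda>i j. A j i) \<star>\<^bsub>boolean_matrices\<^esub> A) i j \<in> U \<longleftrightarrow> E i j \<in> U"
        by (simp add: mem_boolean_matrix_mult[OF A U])
    qed
    moreover have "A \<star>\<^bsub>boolean_matrices\<^esub> (\<lambda>i j. A j i) = F"
    proof (rule boolean_matrix_eqI)
      fix U :: "'a set" and i j assume U: "U \<in> ultrafilters"
      have "(\<exists>k. A i k \<in> U \<and> A j k \<in> U) \<longleftrightarrow> i = j \<and> F i i \<in> U"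
        using boolean_matrix_unique(2)[OF A U] exE[OF U] memA[OF U] by metis
      also have "\<dots> \<longleftrightarrow> F i j \<in> U"
        using diag(2)[OF U] by metis
      finally show "(A \<star>\<^bsub>boolean_matrices\<^esub> (\<lambda>i j. A j i)) i j \<in> U \<longleftrightarrow> F i j \<in> U"
        by (simp add: mem_boolean_matrix_mult[OF boolean_matrix_transpose[OF A] U])
    qed
    ultimately show "green_D boolean_matrices E F"
      using A by (auto simp: green_D_def sinv_boolean_matrix)
  }
qed

lemma interval_idempotent:
  fixes f g :: "'a::boolean_algebra set \<Rightarrow> nat"
  assumes f: "continuous_map stone_space (discrete_topology UNIV) f"
    and g: "continuous_map stone_space (discrete_topology UNIV) g"
  obtains E where "E \<in> idempotents boolean_matrices"
    "\<forall>U\<in>ultrafilters. {i. E i i \<in> U} = {f U..<g U}"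
proof -
  obtain n where n: "\<forall>U\<in>ultrafilters. g U < n"
    using g by (rule stone_space_rank_bounded)
  have cont: "continuous_map stone_space (discrete_topology UNIV) (\<lambda>U. (f U, g U))"
    using f g by (rule continuous_map_discrete_comp2)
  have ex: "\<exists>a. \<forall>U\<in>ultrafilters. a \<in> U \<longleftrightarrow> f U \<le> i \<and> i < g U" for i
  proof -
    obtain a where "\<forall>U\<in>ultrafilters. a \<in> U \<longleftrightarrow> (case (f U, g U) of (m, n) \<Rightarrow> m \<le> i \<and> i < n)"
      using cont by (rule stone_space_level_set_basic[where P = "\<lambda>(m, n). m \<le> i \<and> i < n"])
    then show ?thesis
      by auto
  qed
  then have "\<forall>i. \<exists>a. \<forall>U\<in>ultrafilters. a \<in> U \<longleftrightarrow> f U \<le> i \<and> i < g U" ..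
  from choice[OF this]
  obtain e where e: "\<forall>i. \<forall>U\<in>ultrafilters. e i \<in> U \<longleftrightarrow> f U \<le> i \<and> i < g U" ..
  define E where "E = (\<lambda>i j. if i = j then e i else bot)"
  have memE: "E i j \<in> U \<longleftrightarrow> i = j \<and> f U \<le> i \<and> i < g U" if "U \<in> ultrafilters" for U i j
    using e that ultrafilterD(1)[OF that] by (simp add: E_def)
  have "{(i, j). E i j \<noteq> bot} \<subseteq> {..<n} \<times> {..<n}"
  proof clarify
    fix i j assume "E i j \<noteq> bot"
    then obtain U where U: "U \<in> ultrafilters" "E i j \<in> U"
      by (rule neq_bot_ultrafilter)
    then have "i = j" "i < g U" "g U < n"
      using memE[OF U(1)] n by auto
    then show "i \<in> {..<n} \<and> j \<in> {..<n}"
      by simp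
  qed
  then have "finite {(i, j). E i j \<noteq> bot}"
    by (meson finite_SigmaI finite_subset finite_lessThan)
  then have "E \<in> idempotents boolean_matrices"
    by (rule idempotent_boolean_matrixI) (simp add: memE)
  then show thesis
    by (rule that) (auto simp: memE)
qed

definition idempotents_of_rank ::
  "('a::boolean_algebra set \<Rightarrow> nat) \<Rightarrow> (nat \<Rightarrow> nat \<Rightarrow> 'a) set" where
  "idempotents_of_rank f =
    {E \<in> idempotents boolean_matrices. \<forall>U\<in>ultrafilters. card {i. E i i \<in> U} = f U}"

lemma D_class_idempotents_of_rank:
  assumes "E \<in> idempotents_of_rank f"
  shows "D_class boolean_matrices E = idempotents_of_rank f"
  using assms by (auto simp: D_class_def idempotents_of_rank_def green_D_boolean_matrices_iff)

lemma idempotents_of_rank_nonempty: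
  assumes "f \<in> rank_functions stone_space"
  obtains E where "E \<in> idempotents_of_rank f"
proof -
  have "continuous_map stone_space (discrete_topology UNIV) f"
    using assms by (simp add: rank_functions_def)
  then obtain E where "E \<in> idempotents boolean_matrices"
    "\<forall>U\<in>ultrafilters. {i. E i i \<in> U} = {0..<f U}"
    using interval_idempotent[of "\<lambda>_. 0" f] continuous_map_discrete_const by metis
  then show thesis
    by (intro that[of E]) (simp add: idempotents_of_rank_def)
qed

lemma sjoin_idempotents_of_rank:
  assumes E: "E \<in> idempotents_of_rank f" and F: "F \<in> idempotents_of_rank g"
    and orth: "orthogonal_elts boolean_matrices E F"
  shows "sjoin boolean_matrices {E, F} \<in> idempotents_of_rank (\<lambda>U. f U + g U)"
proof -
  have idem: "E \<in> idempotents boolean_matrices" "F \<in> idempotents boolean_matrices"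
    using E F by (auto simp: idempotents_of_rank_def)
  then have c: "E \<in> carrier boolean_matrices" "F \<in> carrier boolean_matrices"
    by (auto simp: idempotents_def)
  have "card {i. sup (E i i) (F i i) \<in> U} = f U + g U" if U: "U \<in> ultrafilters" for U
  proof -
    have "(\<lambda>i j. E j i) \<star>\<^bsub>boolean_matrices\<^esub> F = (\<lambda>i j. bot)"
      using orth by (simp add: orthogonal_elts_def sinv_boolean_matrix c szero_boolean_matrices)
    then have "\<not> (E i i \<in> U \<and> F i i \<in> U)" for i
      using mem_boolean_matrix_mult[OF c(2) U, of "\<lambda>i j. E j i" i i] ultrafilterD(1)[OF U] by auto
    then have "card ({i. E i i \<in> U} \<union> {i. F i i \<in> U}) = card {i. E i i \<in> U} + card {i. F i i \<in> U}"
      using finite_boolean_matrix_rank_set[OF c(1) U] finite_boolean_matrix_rank_set[OF c(2) U]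
      by (intro card_Un_disjoint) auto
    moreover have "{i. E i i \<in> U} \<union> {i. F i i \<in> U} = {i. sup (E i i) (F i i) \<in> U}"
      by (auto simp: sup_mem_ultrafilter[OF U])
    ultimately show ?thesis
      using E F U by (simp add: idempotents_of_rank_def)
  qed
  then show ?thesis
    using sjoin_idempotent_boolean_matrices[OF idem] by (simp add: idempotents_of_rank_def)
qed

text \<open>The diagonals are placed side by side: \<open>{0..<f U}\<close> and \<open>{f U..<f U + g U}\<close>.\<close>

lemma orthogonal_idempotents_of_rank:
  fixes f g :: "'a::boolean_algebra set \<Rightarrow> nat"
  assumes f: "f \<in> rank_functions stone_space" and g: "g \<in> rank_functions stone_space"
  obtains E F where "E \<in> idempotents_of_rank f" "F \<in> idempotents_of_rank g"
    "orthogonal_elts boolean_matrices E F"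
proof -
  have fc: "continuous_map stone_space (discrete_topology UNIV) f"
    and gc: "continuous_map stone_space (discrete_topology UNIV) g"
    using f g by (auto simp: rank_functions_def)
  obtain E where E: "E \<in> idempotents boolean_matrices"
    "\<forall>U\<in>ultrafilters. {i. E i i \<in> U} = {0..<f U}"
    using interval_idempotent[OF continuous_map_discrete_const fc] by metis
  obtain F where F: "F \<in> idempotents boolean_matrices"
    "\<forall>U\<in>ultrafilters. {i. F i i \<in> U} = {f U..<f U + g U}"
    using interval_idempotent[OF fc continuous_map_discrete_comp2[OF fc gc, of "(+)"]] by metis
  have c: "E \<in> carrier boolean_matrices" "F \<in> carrier boolean_matrices"
    using E F by (auto simp: idempotents_def)
  have E': "i = j \<and> i < f U" if "U \<in> ultrafilters" "E i j \<in> U" for U i j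
  proof -
    have "i = j"
      using E(1) that unfolding idempotent_boolean_matrix_iff by blast
    then have "i \<in> {i. E i i \<in> U}"
      using that by simp
    then show ?thesis
      using \<open>i = j\<close> E(2) that(1) by simp
  qed
  have F': "i = j \<and> f U \<le> i" if "U \<in> ultrafilters" "F i j \<in> U" for U i j
  proof -
    have "i = j"
      using F(1) that unfolding idempotent_boolean_matrix_iff by blast
    then have "i \<in> {i. F i i \<in> U}"
      using that by simp
    then show ?thesis
      using \<open>i = j\<close> F(2) that(1) by simp
  qed
  have disj: "E p q \<in> U \<Longrightarrow> F r s \<in> U \<Longrightarrow> p \<noteq> r \<and> q \<noteq> s" if "U \<in> ultrafilters" for U p q r s
    using E'[OF that, of p q] F'[OF that, of r s] by auto
  have "(\<lambda>i j. E j i) \<star>\<^bsub>boolean_matrices\<^esub> F = (\<lambda>i j. bot)"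
  proof (rule boolean_matrix_eqI)
    fix U :: "'a set" and i j assume U: "U \<in> ultrafilters"
    show "((\<lambda>i j. E j i) \<star>\<^bsub>boolean_matrices\<^esub> F) i j \<in> U \<longleftrightarrow> bot \<in> U"
      using disj[OF U] unfolding mem_boolean_matrix_mult[OF c(2) U]
      by (metis ultrafilterD(1)[OF U])
  qed
  moreover have "E \<star>\<^bsub>boolean_matrices\<^esub> (\<lambda>i j. F j i) = (\<lambda>i j. bot)"
  proof (rule boolean_matrix_eqI)
    fix U :: "'a set" and i j assume U: "U \<in> ultrafilters"
    show "(E \<star>\<^bsub>boolean_matrices\<^esub> (\<lambda>i j. F j i)) i j \<in> U \<longleftrightarrow> bot \<in> U"
      using disj[OF U] unfolding mem_boolean_matrix_mult[OF boolean_matrix_transpose[OF c(2)] U]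
      by (metis ultrafilterD(1)[OF U])
  qed
  ultimately have "orthogonal_elts boolean_matrices E F"
    by (simp add: orthogonal_elts_def sinv_boolean_matrix c szero_boolean_matrices)
  moreover have "E \<in> idempotents_of_rank f" "F \<in> idempotents_of_rank g"
    using E F by (auto simp: idempotents_of_rank_def)
  ultimately show thesis
    using that by blast
qed

lemma K_group_boolean_semigroup:
  "comm_group (K_group (boolean_semigroup :: 'a::boolean_algebra semigrp))"
  "continuous_int_group (stone_space :: 'a set topology) \<cong> K_group (boolean_semigroup :: 'a semigrp)"
proof -
  let ?N = "rank_functions (stone_space :: 'a set topology)"
  let ?M = "boolean_matrices :: (nat \<Rightarrow> nat \<Rightarrow> 'a) semigrp"
  have carr: "carrier (idempotent_class_monoid ?M) = idempotents_of_rank ` ?N"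
  proof (intro equalityI subsetI)
    fix P assume "P \<in> carrier (idempotent_class_monoid ?M)"
    then obtain E where E: "E \<in> idempotents ?M" "P = D_class ?M E"
      by (auto simp: idempotent_class_monoid_def)
    define f where "f = (\<lambda>U. if U \<in> topspace stone_space then card {i. E i i \<in> U} else 0)"
    have D: "continuous_map stone_space (discrete_topology UNIV) (\<lambda>U. {i. E i i \<in> U})"
      using E by (intro continuous_map_boolean_matrix_diagonal) (simp add: idempotents_def)
    have "continuous_map stone_space (discrete_topology UNIV) f"
      unfolding f_def by (rule continuous_map_discrete_if)
        (rule continuous_map_discrete_comp2[OF D D, of "\<lambda>I _. card I"])
    then have "f \<in> ?N"
      by (simp add: rank_functions_def f_def)
    moreover have "E \<in> idempotents_of_rank f"
      using E by (simp add: idempotents_of_rank_def f_def)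
    ultimately show "P \<in> idempotents_of_rank ` ?N"
      using E(2) D_class_idempotents_of_rank by blast
  next
    fix P assume "P \<in> idempotents_of_rank ` ?N"
    then obtain f where f: "f \<in> ?N" "P = idempotents_of_rank f"
      by blast
    then obtain E where E: "E \<in> idempotents_of_rank f"
      using idempotents_of_rank_nonempty by blast
    then have "P = D_class ?M E" "E \<in> idempotents ?M"
      using f D_class_idempotents_of_rank by (auto simp: idempotents_of_rank_def)
    then show "P \<in> carrier (idempotent_class_monoid ?M)"
      by (auto simp: idempotent_class_monoid_def)
  qed
  have inj: "inj_on idempotents_of_rank ?N"
  proof (rule inj_onI)
    fix f g assume f: "f \<in> ?N" and g: "g \<in> ?N" and eq: "idempotents_of_rank f = idempotents_of_rank g"
    obtain E where "E \<in> idempotents_of_rank f"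
      using f by (rule idempotents_of_rank_nonempty)
    with eq have "E \<in> idempotents_of_rank f" "E \<in> idempotents_of_rank g"
      by auto
    then have *: "f U = g U" if "U \<in> ultrafilters" for U
      using that by (simp add: idempotents_of_rank_def)
    show "f = g"
    proof
      show "f U = g U" for U
        using f g * by (cases "U \<in> ultrafilters") (simp_all add: rank_functions_def)
    qed
  qed
  have mult: "idempotents_of_rank f \<otimes>\<^bsub>idempotent_class_monoid ?M\<^esub> idempotents_of_rank g =
      idempotents_of_rank (\<lambda>U. f U + g U)" if f: "f \<in> ?N" and g: "g \<in> ?N" for f g
  proof -
    let ?S = "{D_class ?M (sjoin ?M {E, F}) | E F.
      E \<in> idempotents_of_rank f \<and> F \<in> idempotents_of_rank g \<and> orthogonal_elts ?M E F}"
    have eq: "D_class ?M (sjoin ?M {E, F}) = idempotents_of_rank (\<lambda>U. f U + g U)"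
      if "E \<in> idempotents_of_rank f" "F \<in> idempotents_of_rank g" "orthogonal_elts ?M E F" for E F
      using that by (intro D_class_idempotents_of_rank sjoin_idempotents_of_rank)
    obtain E F where EF: "E \<in> idempotents_of_rank f" "F \<in> idempotents_of_rank g"
      "orthogonal_elts ?M E F"
      using f g by (rule orthogonal_idempotents_of_rank)
    have "?S = {idempotents_of_rank (\<lambda>U. f U + g U)}"
    proof (intro equalityI subsetI)
      fix P assume "P \<in> ?S"
      then show "P \<in> {idempotents_of_rank (\<lambda>U. f U + g U)}"
        using eq by auto
    next
      fix P assume "P \<in> {idempotents_of_rank (\<lambda>U. f U + g U)}"
      then show "P \<in> ?S"
        using EF eq[OF EF] by (intro CollectI exI[of _ E] exI[of _ F]) simp
    qed
    then show ?thesis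
      by (simp add: idempotent_class_monoid_def)
  qed
  have "szero ?M \<in> idempotents_of_rank (\<lambda>_. 0)"
    by (simp add: szero_boolean_matrices idempotents_of_rank_def idempotent_boolean_matrix_iff
        zero_boolean_matrix ultrafilterD(1))
  then have one: "\<one>\<^bsub>idempotent_class_monoid ?M\<^esub> = idempotents_of_rank (\<lambda>_. 0)"
    by (simp add: idempotent_class_monoid_def D_class_idempotents_of_rank)
  show "comm_group (K_group (boolean_semigroup :: 'a semigrp))"
    "continuous_int_group (stone_space :: 'a set topology) \<cong> K_group (boolean_semigroup :: 'a semigrp)"
    unfolding K_group_def using grothendieck_group_rank_functions[OF carr inj mult one] by blast+
qed

section \<open>Isomorphism of vector bundles\<close>

text \<open>The part of being a vector bundle that inverting an isomorphism needs. Unlike local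
  triviality, it passes to Whitney sums at once.\<close>

definition fibrewise_closed :: "('x, 'e) vbundle \<Rightarrow> bool" where
  "fibrewise_closed B \<longleftrightarrow> (\<forall>x. \<forall>e\<in>fibre B x. \<forall>f\<in>fibre B x. badd B e f \<in> fibre B x) \<and>
    (\<forall>x c. \<forall>e\<in>fibre B x. bscale B c e \<in> fibre B x)"

lemma fibrewise_closedD:
  assumes "fibrewise_closed B"
  shows "e \<in> fibre B x \<Longrightarrow> f \<in> fibre B x \<Longrightarrow> badd B e f \<in> fibre B x"
    and "e \<in> fibre B x \<Longrightarrow> bscale B c e \<in> fibre B x"
  using assms unfolding fibrewise_closed_def by blast+

lemma bproj_in_topspace:
  assumes "vector_bundle X B" "e \<in> topspace (tspace B)"
  shows "bproj B e \<in> topspace X"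
  using assms continuous_map_image_subset_topspace unfolding vector_bundle_def by blast

lemma vector_bundle_fibrewise_closed:
  assumes B: "vector_bundle X B"
  shows "fibrewise_closed B"
proof -
  have V: "complex_vector_space_on (fibre B x) (badd B) (bscale B)" if "e \<in> fibre B x" for e x
  proof -
    have "x \<in> topspace X"
      using that bproj_in_topspace[OF B, of e] by (simp add: preim_def)
    then show ?thesis
      using B by (simp add: vector_bundle_def)
  qed
  show ?thesis
    unfolding fibrewise_closed_def
  proof (intro conjI allI ballI)
    fix x e f assume ef: "e \<in> fibre B x" "f \<in> fibre B x"
    obtain z where "comm_group \<lparr>carrier = fibre B x, mult = badd B, one = z\<rparr>"
      using V[OF ef(1)] unfolding complex_vector_space_on_def by blast
    then interpret G: comm_group "\<lparr>carrier = fibre B x, mult = badd B, one = z\<rparr>" .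
    show "badd B e f \<in> fibre B x"
      using G.m_closed ef by simp
  next
    fix x c e assume e: "e \<in> fibre B x"
    show "bscale B c e \<in> fibre B x"
      using V[OF e] e unfolding complex_vector_space_on_def by blast
  qed
qed

lemma bundle_iso_fibre:
  assumes h: "bundle_iso B C h" and e: "e \<in> fibre B x"
  shows "h e \<in> fibre C x"
proof -
  have e': "e \<in> topspace (tspace B)" "bproj B e = x"
    using e by (auto simp: preim_def)
  have "h ` topspace (tspace B) = topspace (tspace C)"
    using h homeomorphic_imp_surjective_map unfolding bundle_iso_def by blast
  then have "h e \<in> topspace (tspace C)"
    using e'(1) by blast
  moreover have "bproj C (h e) = x"
    using h e' unfolding bundle_iso_def by blast
  ultimately show ?thesis
    by (simp add: preim_def)
qed

lemma bundle_isoD: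
  assumes "bundle_iso B C h"
  shows "homeomorphic_map (tspace B) (tspace C) h"
    and "e \<in> topspace (tspace B) \<Longrightarrow> bproj C (h e) = bproj B e"
    and "e \<in> fibre B x \<Longrightarrow> f \<in> fibre B x \<Longrightarrow> h (badd B e f) = badd C (h e) (h f)"
    and "e \<in> fibre B x \<Longrightarrow> h (bscale B c e) = bscale C c (h e)"
  using assms unfolding bundle_iso_def by blast+

lemma bundle_isomorphic_refl: "bundle_isomorphic B B"
proof -
  have "bundle_iso B B id"
    by (simp add: bundle_iso_def)
  then show ?thesis
    unfolding bundle_isomorphic_def by blast
qed

lemma bundle_isomorphic_trans:
  assumes "bundle_isomorphic B C" "bundle_isomorphic C D"
  shows "bundle_isomorphic B D"
proof -
  obtain h k where h: "bundle_iso B C h" and k: "bundle_iso C D k"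
    using assms unfolding bundle_isomorphic_def by blast
  have top: "h e \<in> topspace (tspace C)" if "e \<in> topspace (tspace B)" for e
    using bundle_iso_fibre[OF h, of e "bproj B e"] that by (simp add: preim_def)
  have "bundle_iso B D (k \<circ> h)"
    unfolding bundle_iso_def
  proof (intro conjI ballI allI)
    show "homeomorphic_map (tspace B) (tspace D) (k \<circ> h)"
      using bundle_isoD(1)[OF h] bundle_isoD(1)[OF k] by (rule homeomorphic_map_compose)
    show "bproj D ((k \<circ> h) e) = bproj B e" if "e \<in> topspace (tspace B)" for e
      using bundle_isoD(2)[OF h that] bundle_isoD(2)[OF k top[OF that]] by simp
    show "(k \<circ> h) (badd B e f) = badd D ((k \<circ> h) e) ((k \<circ> h) f)"
      if "e \<in> fibre B x" "f \<in> fibre B x" for x e f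
      using bundle_isoD(3)[OF h that]
        bundle_isoD(3)[OF k bundle_iso_fibre[OF h that(1)] bundle_iso_fibre[OF h that(2)]] by simp
    show "(k \<circ> h) (bscale B c e) = bscale D c ((k \<circ> h) e)" if "e \<in> fibre B x" for x c e
      using bundle_isoD(4)[OF h that] bundle_isoD(4)[OF k bundle_iso_fibre[OF h that]] by simp
  qed
  then show ?thesis
    unfolding bundle_isomorphic_def by blast
qed

lemma bundle_isomorphic_sym:
  assumes B: "fibrewise_closed B" and iso: "bundle_isomorphic B C"
  shows "bundle_isomorphic C B"
proof -
  obtain h where h: "bundle_iso B C h"
    using iso unfolding bundle_isomorphic_def by blast
  obtain g where hg: "homeomorphic_maps (tspace B) (tspace C) h g"
    using bundle_isoD(1)[OF h] unfolding homeomorphic_map_maps by blast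
  have gh: "g (h e) = e" if "e \<in> topspace (tspace B)" for e
    using hg that unfolding homeomorphic_maps_def by blast
  have onto: "\<exists>e\<in>fibre B x. u = h e" if u: "u \<in> fibre C x" for u x
  proof -
    have "u \<in> topspace (tspace C)" "bproj C u = x"
      using u by (auto simp: preim_def)
    then obtain e where e: "e \<in> topspace (tspace B)" "u = h e"
      using homeomorphic_imp_surjective_map[OF bundle_isoD(1)[OF h]] by blast
    then have "e \<in> fibre B x"
      using \<open>bproj C u = x\<close> bundle_isoD(2)[OF h e(1)] by (simp add: preim_def)
    with e(2) show ?thesis
      by blast
  qed
  have ghf: "g (h e) = e" if "e \<in> fibre B x" for e x
    using that gh by (simp add: preim_def)
  have "bundle_iso C B g"
    unfolding bundle_iso_def
  proof (intro conjI ballI allI)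
    show "homeomorphic_map (tspace C) (tspace B) g"
      using homeomorphic_maps_sym[THEN iffD1, OF hg] unfolding homeomorphic_map_maps by blast
    show "bproj B (g u) = bproj C u" if u: "u \<in> topspace (tspace C)" for u
    proof -
      have "u \<in> fibre C (bproj C u)"
        using u by (simp add: preim_def)
      from onto[OF this] obtain e where "e \<in> fibre B (bproj C u)" "u = h e"
        by blast
      then show ?thesis
        using ghf by (simp add: preim_def)
    qed
    show "g (badd C u v) = badd B (g u) (g v)" if uv: "u \<in> fibre C x" "v \<in> fibre C x" for x u v
    proof -
      obtain e f where e: "e \<in> fibre B x" "u = h e" and f: "f \<in> fibre B x" "v = h f"
        using onto[OF uv(1)] onto[OF uv(2)] by blast
      have "badd C u v = h (badd B e f)"
        using bundle_isoD(3)[OF h e(1) f(1)] e(2) f(2) by simp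
      then show ?thesis
        using ghf[OF fibrewise_closedD(1)[OF B e(1) f(1)]] ghf[OF e(1)] ghf[OF f(1)] e(2) f(2)
        by simp
    qed
    show "g (bscale C c u) = bscale B c (g u)" if u: "u \<in> fibre C x" for x c u
    proof -
      obtain e where e: "e \<in> fibre B x" "u = h e"
        using onto[OF u] by blast
      have "bscale C c u = h (bscale B c e)"
        using bundle_isoD(4)[OF h e(1)] e(2) by simp
      then show ?thesis
        using ghf[OF fibrewise_closedD(2)[OF B e(1)]] ghf[OF e(1)] e(2) by simp
    qed
  qed
  then show ?thesis
    unfolding bundle_isomorphic_def by blast
qed

lemma bundle_class_eq:
  assumes B: "fibrewise_closed B" and iso: "bundle_isomorphic B C"
  shows "bundle_class X B = bundle_class X C"
  unfolding bundle_class_def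
  using bundle_isomorphic_trans[OF iso] bundle_isomorphic_trans[OF bundle_isomorphic_sym[OF B iso]]
  by blast

lemma fibre_whitney_sum:
  "(e, f) \<in> fibre (whitney_sum B C) x \<longleftrightarrow> e \<in> fibre B x \<and> f \<in> fibre C x"
  by (auto simp: preim_def whitney_sum_def)

lemma fibrewise_closed_whitney_sum:
  assumes "fibrewise_closed B" "fibrewise_closed C"
  shows "fibrewise_closed (whitney_sum B C)"
proof -
  have op: "badd (whitney_sum B C) (e, f) (e', f') = (badd B e e', badd C f f')"
    "bscale (whitney_sum B C) c (e, f) = (bscale B c e, bscale C c f)" for e f e' f' c
    by (simp_all add: whitney_sum_def)
  show ?thesis
    unfolding fibrewise_closed_def
    by (auto simp: fibre_whitney_sum op fibrewise_closedD[OF assms(1)] fibrewise_closedD[OF assms(2)])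
qed

lemma whitney_sum_isomorphic:
  assumes "bundle_isomorphic B B'" "bundle_isomorphic C C'"
  shows "bundle_isomorphic (whitney_sum B C) (whitney_sum B' C')"
proof -
  obtain h k where h: "bundle_iso B B' h" and k: "bundle_iso C C' k"
    using assms unfolding bundle_isomorphic_def by blast
  let ?f = "\<lambda>(e, f). (h e, k f)"
  let ?D = "{(e, f). bproj B e = bproj C f}" and ?D' = "{(e, f). bproj B' e = bproj C' f}"
  obtain h' where h': "homeomorphic_maps (tspace B) (tspace B') h h'"
    using bundle_isoD(1)[OF h] unfolding homeomorphic_map_maps by blast
  obtain k' where k': "homeomorphic_maps (tspace C) (tspace C') k k'"
    using bundle_isoD(1)[OF k] unfolding homeomorphic_map_maps by blast
  have "homeomorphic_maps (prod_topology (tspace B) (tspace C)) (prod_topology (tspace B') (tspace C'))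
      ?f (\<lambda>(e, f). (h' e, k' f))"
    using h' k' by (simp add: homeomorphic_maps_prod)
  then have hom: "homeomorphic_map (prod_topology (tspace B) (tspace C)) (prod_topology (tspace B') (tspace C')) ?f"
    unfolding homeomorphic_map_maps by blast
  have "?f ` (topspace (prod_topology (tspace B) (tspace C)) \<inter> ?D) =
      topspace (prod_topology (tspace B') (tspace C')) \<inter> ?D'"
  proof (intro equalityI subsetI)
    fix u assume "u \<in> ?f ` (topspace (prod_topology (tspace B) (tspace C)) \<inter> ?D)"
    then obtain e f where ef: "e \<in> fibre B (bproj B e)" "f \<in> fibre C (bproj B e)" "u = (h e, k f)"
      by (auto simp: preim_def)
    then show "u \<in> topspace (prod_topology (tspace B') (tspace C')) \<inter> ?D'"
      using bundle_iso_fibre[OF h ef(1)] bundle_iso_fibre[OF k ef(2)] by (simp add: preim_def)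
  next
    fix u assume "u \<in> topspace (prod_topology (tspace B') (tspace C')) \<inter> ?D'"
    then obtain e' f' where ef': "e' \<in> topspace (tspace B')" "f' \<in> topspace (tspace C')"
      "bproj B' e' = bproj C' f'" "u = (e', f')"
      by auto
    obtain e where e: "e \<in> topspace (tspace B)" "e' = h e"
      using ef'(1) homeomorphic_imp_surjective_map[OF bundle_isoD(1)[OF h]] by blast
    obtain f where f: "f \<in> topspace (tspace C)" "f' = k f"
      using ef'(2) homeomorphic_imp_surjective_map[OF bundle_isoD(1)[OF k]] by blast
    have "bproj B e = bproj C f"
      using ef'(3) bundle_isoD(2)[OF h e(1)] bundle_isoD(2)[OF k f(1)] e(2) f(2) by simp
    then have "(e, f) \<in> topspace (prod_topology (tspace B) (tspace C)) \<inter> ?D" "u = ?f (e, f)"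
      using e f ef'(4) by auto
    then show "u \<in> ?f ` (topspace (prod_topology (tspace B) (tspace C)) \<inter> ?D)"
      by blast
  qed
  then have "homeomorphic_map (tspace (whitney_sum B C)) (tspace (whitney_sum B' C')) ?f"
    using homeomorphic_map_subtopologies[OF hom] by (simp add: whitney_sum_def)
  moreover have "bproj (whitney_sum B' C') (?f u) = bproj (whitney_sum B C) u"
    if "u \<in> topspace (tspace (whitney_sum B C))" for u
    using that bundle_isoD(2)[OF h, of "fst u"] by (auto simp: whitney_sum_def)
  moreover have "?f (badd (whitney_sum B C) u v) = badd (whitney_sum B' C') (?f u) (?f v)"
    if "u \<in> fibre (whitney_sum B C) x" "v \<in> fibre (whitney_sum B C) x" for u v x
    using that bundle_isoD(3)[OF h, of "fst u" x "fst v"] bundle_isoD(3)[OF k, of "snd u" x "snd v"]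
    by (cases u; cases v) (simp add: fibre_whitney_sum, simp add: whitney_sum_def)
  moreover have "?f (bscale (whitney_sum B C) c u) = bscale (whitney_sum B' C') c (?f u)"
    if "u \<in> fibre (whitney_sum B C) x" for u c x
    using that bundle_isoD(4)[OF h, of "fst u" x c] bundle_isoD(4)[OF k, of "snd u" x c]
    by (cases u) (simp add: fibre_whitney_sum, simp add: whitney_sum_def)
  ultimately have "bundle_iso (whitney_sum B C) (whitney_sum B' C') ?f"
    unfolding bundle_iso_def by blast
  then show ?thesis
    unfolding bundle_isomorphic_def by blast
qed

section \<open>Standard bundles\<close>

abbreviation sequence_product :: "'x topology \<Rightarrow> ('x \<times> (nat \<Rightarrow> complex)) topology" where
  "sequence_product X \<equiv> prod_topology X (product_topology (\<lambda>_. euclidean) UNIV)"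

text \<open>The bundle with fibre \<open>\<complex>\<^bsup>r x\<^esup>\<close> at \<open>x\<close>, as a subspace of the product of \<open>X\<close> with the space
  of all sequences.\<close>

definition standard_bundle :: "'x topology \<Rightarrow> ('x \<Rightarrow> nat) \<Rightarrow> 'x ubundle" where
  "standard_bundle X r = \<lparr>
     tspace = subtopology (sequence_product X) {(x, z). \<forall>i\<ge>r x. z i = 0},
     bproj = fst,
     badd = (\<lambda>(x, z) (y, w). (x, \<lambda>i. z i + w i)),
     bscale = (\<lambda>c (x, z). (x, \<lambda>i. c * z i))\<rparr>"

lemma standard_bundle_simps:
  "tspace (standard_bundle X r) = subtopology (sequence_product X) {(x, z). \<forall>i\<ge>r x. z i = 0}"
  "bproj (standard_bundle X r) = fst"
  "badd (standard_bundle X r) (x, z) (y, w) = (x, \<lambda>i. z i + w i)"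
  "bscale (standard_bundle X r) c (x, z) = (x, \<lambda>i. c * z i)"
  by (simp_all add: standard_bundle_def)

lemma topspace_standard_bundle:
  "topspace (tspace (standard_bundle X r)) = {(x, z). x \<in> topspace X \<and> (\<forall>i\<ge>r x. z i = 0)}"
  by (auto simp: standard_bundle_simps)

lemma preim_standard_bundle:
  "(x, z) \<in> preim (standard_bundle X r) U \<longleftrightarrow> x \<in> topspace X \<inter> U \<and> (\<forall>i\<ge>r x. z i = 0)"
  by (auto simp: preim_def topspace_standard_bundle standard_bundle_simps(2))

lemma fibre_standard_bundle:
  "u \<in> fibre (standard_bundle X r) x \<longleftrightarrow>
    x \<in> topspace X \<and> (\<exists>z. u = (x, z) \<and> (\<forall>i\<ge>r x. z i = 0))"
  by (cases u) (auto simp: preim_standard_bundle)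

lemma continuous_map_sequence_product:
  "continuous_map T (sequence_product X) f \<longleftrightarrow>
    continuous_map T X (\<lambda>t. fst (f t)) \<and> (\<forall>i. continuous_map T euclidean (\<lambda>t. snd (f t) i))"
  by (simp add: continuous_map_pairwise continuous_map_componentwise_UNIV o_def)

lemma continuous_map_standard_bundle:
  "continuous_map T (tspace (standard_bundle X r)) f \<longleftrightarrow>
    continuous_map T X (\<lambda>t. fst (f t)) \<and> (\<forall>i. continuous_map T euclidean (\<lambda>t. snd (f t) i)) \<and>
    (\<forall>t\<in>topspace T. \<forall>i\<ge>r (fst (f t)). snd (f t) i = 0)"
  by (auto simp: standard_bundle_simps continuous_map_in_subtopology continuous_map_sequence_product
      image_subset_iff Pi_iff split_beta)

lemma continuous_map_standard_bundle_coordinates: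
  "continuous_map (tspace (standard_bundle X r)) X fst"
  "continuous_map (tspace (standard_bundle X r)) euclidean (\<lambda>u. snd u i)"
proof -
  have "continuous_map (tspace (standard_bundle X r)) (tspace (standard_bundle X r)) (\<lambda>u. u)"
    by simp
  then show "continuous_map (tspace (standard_bundle X r)) X fst"
    "continuous_map (tspace (standard_bundle X r)) euclidean (\<lambda>u. snd u i)"
    unfolding continuous_map_standard_bundle by blast+
qed

lemma complex_vector_space_on_standard_fibre:
  assumes x: "x \<in> topspace X"
  shows "complex_vector_space_on (fibre (standard_bundle X r) x) (badd (standard_bundle X r))
    (bscale (standard_bundle X r))"
proof -
  let ?B = "standard_bundle X r"
  let ?G = "\<lparr>carrier = fibre ?B x, mult = badd ?B, one = (x, \<lambda>_. 0)\<rparr>"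
  have "comm_group ?G"
  proof (rule comm_groupI)
    show "u \<otimes>\<^bsub>?G\<^esub> v \<in> carrier ?G" if "u \<in> carrier ?G" "v \<in> carrier ?G" for u v
      using that by (auto simp: fibre_standard_bundle standard_bundle_simps)
    show "\<one>\<^bsub>?G\<^esub> \<in> carrier ?G"
      using x by (simp add: fibre_standard_bundle)
    show "u \<otimes>\<^bsub>?G\<^esub> v \<otimes>\<^bsub>?G\<^esub> w = u \<otimes>\<^bsub>?G\<^esub> (v \<otimes>\<^bsub>?G\<^esub> w)"
      if "u \<in> carrier ?G" "v \<in> carrier ?G" "w \<in> carrier ?G" for u v w
      using that by (auto simp: fibre_standard_bundle standard_bundle_simps add.assoc)
    show "u \<otimes>\<^bsub>?G\<^esub> v = v \<otimes>\<^bsub>?G\<^esub> u" if "u \<in> carrier ?G" "v \<in> carrier ?G" for u v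
      using that by (auto simp: fibre_standard_bundle standard_bundle_simps add.commute)
    show "\<one>\<^bsub>?G\<^esub> \<otimes>\<^bsub>?G\<^esub> u = u" if "u \<in> carrier ?G" for u
      using that by (auto simp: fibre_standard_bundle standard_bundle_simps)
    show "\<exists>v\<in>carrier ?G. v \<otimes>\<^bsub>?G\<^esub> u = \<one>\<^bsub>?G\<^esub>" if u: "u \<in> carrier ?G" for u
    proof -
      obtain z where z: "u = (x, z)" "\<forall>i\<ge>r x. z i = 0"
        using u by (auto simp: fibre_standard_bundle)
      have "(x, \<lambda>i. - z i) \<in> carrier ?G" "(x, \<lambda>i. - z i) \<otimes>\<^bsub>?G\<^esub> u = \<one>\<^bsub>?G\<^esub>"
        using x z by (simp_all add: fibre_standard_bundle standard_bundle_simps)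
      then show ?thesis
        by blast
    qed
  qed
  then show ?thesis
    unfolding complex_vector_space_on_def
    by (auto simp: fibre_standard_bundle standard_bundle_simps algebra_simps)
qed

text \<open>On the open set where \<open>r\<close> is constant, the bundle is literally a product.\<close>

lemma vector_bundle_standard_bundle:
  assumes r: "continuous_map X (discrete_topology UNIV) r"
  shows "vector_bundle X (standard_bundle X r)"
  unfolding vector_bundle_def
proof (intro conjI ballI)
  let ?B = "standard_bundle X r"
  show "continuous_map (tspace ?B) X (bproj ?B)"
    using continuous_map_standard_bundle_coordinates(1)[of X r] by (simp add: standard_bundle_simps)
  show "complex_vector_space_on (fibre ?B x) (badd ?B) (bscale ?B)" if "x \<in> topspace X" for x
    using that by (rule complex_vector_space_on_standard_fibre)
  show "\<exists>U n h. x \<in> U \<and> local_trivialization X ?B U n h" if x: "x \<in> topspace X" for x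
  proof -
    let ?U = "{y \<in> topspace X. r y = r x}" and ?Z = "{z :: nat \<Rightarrow> complex. \<forall>i\<ge>r x. z i = 0}"
    have 1: "openin X ?U"
      using r unfolding continuous_map_discrete_iff by blast
    have "subtopology (tspace ?B) (preim ?B ?U) =
        prod_topology (subtopology X ?U) (complex_space (r x))"
    proof -
      have "{(y, z). \<forall>i\<ge>r y. z i = 0} \<inter> preim ?B ?U = ?U \<times> ?Z"
        by (auto simp: preim_standard_bundle)
      then show ?thesis
        by (simp add: complex_space_def subtopology_Times[symmetric] standard_bundle_simps(1)
            subtopology_subtopology)
    qed
    then have 2: "homeomorphic_map (subtopology (tspace ?B) (preim ?B ?U))
        (prod_topology (subtopology X ?U) (complex_space (r x))) id"
      by (simp only: homeomorphic_map_id)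
    have 3: "fst (id e) = bproj ?B e" for e
      by (simp add: standard_bundle_simps)
    have 4: "snd (id (badd ?B e f)) = (\<lambda>i. snd (id e) i + snd (id f) i)" for e f
      by (cases e; cases f) (simp add: standard_bundle_simps)
    have 5: "snd (id (bscale ?B c e)) = (\<lambda>i. c * snd (id e) i)" for c e
      by (cases e) (simp add: standard_bundle_simps)
    have "local_trivialization X ?B ?U (r x) id"
      unfolding local_trivialization_def by (intro conjI ballI allI; rule 1 2 3 4 5)
    moreover have "x \<in> ?U"
      using x by simp
    ultimately show ?thesis
      by (intro exI[of _ ?U] exI[of _ "r x"] exI[of _ id] conjI)
  qed
qed

text \<open>Invariance of dimension. The images of the \<open>n\<close> unit vectors are independent and lie in the
  span of \<open>m\<close> unit vectors.\<close>

lemma finite_dimensional_injection_le: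
  fixes \<phi> :: "(nat \<Rightarrow> complex) \<Rightarrow> nat \<Rightarrow> complex"
  defines "V \<equiv> \<lambda>n. {z :: nat \<Rightarrow> complex. \<forall>i\<ge>n. z i = 0}"
  assumes range: "\<And>z. z \<in> V n \<Longrightarrow> \<phi> z \<in> V m"
    and add: "\<And>z w. z \<in> V n \<Longrightarrow> w \<in> V n \<Longrightarrow> \<phi> (\<lambda>i. z i + w i) = (\<lambda>i. \<phi> z i + \<phi> w i)"
    and scale: "\<And>c z. z \<in> V n \<Longrightarrow> \<phi> (\<lambda>i. c * z i) = (\<lambda>i. c * \<phi> z i)"
    and inj: "inj_on \<phi> (V n)"
  shows "n \<le> m"
proof -
  interpret vs: vector_space "\<lambda>(c :: complex) (z :: nat \<Rightarrow> complex) i. c * z i"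
    by unfold_locales (auto simp: fun_eq_iff algebra_simps)
  define e :: "nat \<Rightarrow> nat \<Rightarrow> complex" where "e = (\<lambda>j i. if i = j then 1 else 0)"
  have eV: "e j \<in> V n" if "j < n" for j n
    using that by (auto simp: e_def V_def)
  \<comment> \<open>Linearity is given for two summands only; summing along the coordinates extends it.\<close>
  have truncate: "\<phi> (\<lambda>i. if i < k then c i else 0) = (\<Sum>j<k. (\<lambda>i. c j * \<phi> (e j) i))" if "k \<le> n" for k c
    using that
  proof (induction k)
    case 0
    have "(\<lambda>_. 0) \<in> V n"
      by (simp add: V_def)
    from scale[OF this, of 0] show ?case
      by (simp add: zero_fun_def)
  next
    case (Suc k)
    have "(\<lambda>i. if i < Suc k then c i else 0) = (\<lambda>i. (if i < k then c i else 0) + c k * e k i)"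
      by (auto simp: fun_eq_iff e_def less_Suc_eq)
    moreover have "(\<lambda>i. if i < k then c i else 0) \<in> V n" "(\<lambda>i. c k * e k i) \<in> V n"
      using Suc.prems by (auto simp: V_def e_def)
    ultimately have "\<phi> (\<lambda>i. if i < Suc k then c i else 0) =
        (\<lambda>i. \<phi> (\<lambda>i. if i < k then c i else 0) i + c k * \<phi> (e k) i)"
      using add scale[OF eV] Suc.prems by simp
    then show ?case
      using Suc by (simp add: plus_fun_def)
  qed
  define S where "S = (\<lambda>j. \<phi> (e j)) ` {..<n}"
  have inj_e: "inj_on (\<lambda>j. \<phi> (e j)) {..<n}"
  proof (rule inj_onI)
    fix j k assume jk: "j \<in> {..<n}" "k \<in> {..<n}" "\<phi> (e j) = \<phi> (e k)"
    then have "e j = e k"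
      using inj eV by (auto simp: inj_on_def)
    then have "e j j = e k j"
      by simp
    then show "j = k"
      by (simp add: e_def split: if_splits)
  qed
  have "vs.independent S"
  proof (rule vs.independent_if_scalars_zero)
    show "finite S"
      by (simp add: S_def)
    fix f x assume f: "(\<Sum>x\<in>S. (\<lambda>i. f x * x i)) = 0" and x: "x \<in> S"
    define c where "c = (\<lambda>j. f (\<phi> (e j)))"
    let ?c = "\<lambda>i. if i < n then c i else 0"
    have "\<phi> ?c = (\<Sum>j<n. (\<lambda>i. c j * \<phi> (e j) i))"
      by (rule truncate) simp
    also have "\<dots> = (\<Sum>x\<in>S. (\<lambda>i. f x * x i))"
      unfolding S_def using sum.reindex[OF inj_e, of "\<lambda>x i. f x * x i"] by (simp add: c_def o_def)
    also have "\<dots> = \<phi> (\<lambda>_. 0)"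
      using f truncate[of 0 c] by simp
    finally have "\<phi> ?c = \<phi> (\<lambda>_. 0)" .
    moreover have "?c \<in> V n" "(\<lambda>_. 0) \<in> V n"
      by (auto simp: V_def)
    ultimately have "?c = (\<lambda>_. 0)"
      using inj by (simp add: inj_on_def)
    moreover obtain j where "j < n" "x = \<phi> (e j)"
      using x by (auto simp: S_def)
    ultimately show "f x = 0"
      using fun_cong[of ?c "\<lambda>_. 0" j] by (simp add: c_def)
  qed
  moreover have "S \<subseteq> vs.span (e ` {..<m})"
  proof
    fix x assume "x \<in> S"
    then have "x \<in> V m"
      using range eV by (auto simp: S_def)
    have coord: "(\<Sum>j<k. (\<lambda>i. x j * e j i)) = (\<lambda>i. if i < k then x i else 0)" for k
    proof (induction k)
      case (Suc k)
      then show ?case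
        by (auto simp: fun_eq_iff e_def less_Suc_eq)
    qed (simp add: zero_fun_def)
    have "x = (\<Sum>j<m. (\<lambda>i. x j * e j i))"
      unfolding coord using \<open>x \<in> V m\<close> by (auto simp: V_def fun_eq_iff)
    also have "\<dots> \<in> vs.span (e ` {..<m})"
      by (intro vs.span_sum vs.span_scale vs.span_base) simp
    finally show "x \<in> vs.span (e ` {..<m})" .
  qed
  ultimately have "card S \<le> card (e ` {..<m})"
    by (intro vs.independent_span_bound[THEN conjunct2]) simp
  also have "\<dots> \<le> m"
    using card_image_le[of "{..<m}" e] by simp
  finally show "n \<le> m"
    using card_image[OF inj_e] by (simp add: S_def)
qed

lemma standard_bundle_isomorphic_le:
  assumes iso: "bundle_isomorphic (standard_bundle X r) (standard_bundle X s)" and x: "x \<in> topspace X"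
  shows "r x \<le> s x"
proof -
  obtain h where h: "bundle_iso (standard_bundle X r) (standard_bundle X s) h"
    using iso unfolding bundle_isomorphic_def by blast
  let ?V = "\<lambda>n. {z :: nat \<Rightarrow> complex. \<forall>i\<ge>n. z i = 0}"
  have hx: "h (x, z) = (x, snd (h (x, z))) \<and> snd (h (x, z)) \<in> ?V (s x)" if "z \<in> ?V (r x)" for z
    using bundle_iso_fibre[OF h, of "(x, z)" x] x that by (auto simp: fibre_standard_bundle)
  have fib: "(x, z) \<in> fibre (standard_bundle X r) x" if "z \<in> ?V (r x)" for z
    using x that by (simp add: fibre_standard_bundle)
  show ?thesis
  proof (rule finite_dimensional_injection_le[where \<phi> = "\<lambda>z. snd (h (x, z))"])
    show "snd (h (x, z)) \<in> ?V (s x)" if "z \<in> ?V (r x)" for z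
      using hx[OF that] by blast
    show "snd (h (x, \<lambda>i. z i + w i)) = (\<lambda>i. snd (h (x, z)) i + snd (h (x, w)) i)"
      if z: "z \<in> ?V (r x)" and w: "w \<in> ?V (r x)" for z w
    proof -
      obtain a b where ab: "h (x, z) = (x, a)" "h (x, w) = (x, b)"
        using hx[OF z] hx[OF w] by blast
      show ?thesis
        using bundle_isoD(3)[OF h fib[OF z] fib[OF w]] by (simp add: standard_bundle_simps ab)
    qed
    show "snd (h (x, \<lambda>i. c * z i)) = (\<lambda>i. c * snd (h (x, z)) i)" if z: "z \<in> ?V (r x)" for c z
    proof -
      obtain a where a: "h (x, z) = (x, a)"
        using hx[OF z] by blast
      show ?thesis
        using bundle_isoD(4)[OF h fib[OF z], of c] by (simp add: standard_bundle_simps a)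
    qed
    show "inj_on (\<lambda>z. snd (h (x, z))) (?V (r x))"
    proof (rule inj_onI)
      fix z w assume zw: "z \<in> ?V (r x)" "w \<in> ?V (r x)" "snd (h (x, z)) = snd (h (x, w))"
      then have "h (x, z) = h (x, w)"
        using hx[OF zw(1)] hx[OF zw(2)] by metis
      moreover have "inj_on h (topspace (tspace (standard_bundle X r)))"
        using bundle_isoD(1)[OF h] homeomorphic_imp_injective_map by blast
      moreover have "(x, z) \<in> topspace (tspace (standard_bundle X r))"
        "(x, w) \<in> topspace (tspace (standard_bundle X r))"
        using fib[OF zw(1)] fib[OF zw(2)] by (simp_all add: preim_def)
      ultimately have "(x, z) = (x, w)"
        by (metis inj_onD)
      then show "z = w"
        by simp
    qed
  qed
qed

text \<open>Fibrewise, this is the concatenation \<open>\<complex>\<^sup>m \<times> \<complex>\<^sup>n \<rightarrow> \<complex>\<^bsup>m+n\<^esup>\<close>, which shifts the second factor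
  by the rank of the first. The shift is locally constant, so both directions are continuous.\<close>

lemma whitney_sum_standard_bundle:
  assumes r: "continuous_map X (discrete_topology UNIV) r"
    and s: "continuous_map X (discrete_topology UNIV) s"
  shows "bundle_isomorphic (whitney_sum (standard_bundle X r) (standard_bundle X s))
    (standard_bundle X (\<lambda>x. r x + s x))"
proof -
  let ?B = "standard_bundle X r" and ?C = "standard_bundle X s"
  let ?W = "whitney_sum ?B ?C" and ?D = "standard_bundle X (\<lambda>x. r x + s x)"
  define f :: "('a \<times> (nat \<Rightarrow> complex)) \<times> ('a \<times> (nat \<Rightarrow> complex)) \<Rightarrow> 'a \<times> (nat \<Rightarrow> complex)" where
    "f = (\<lambda>t. (fst (fst t),
      \<lambda>i. if i < r (fst (fst t)) then snd (fst t) i else snd (snd t) (i - r (fst (fst t)))))"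
  define g :: "'a \<times> (nat \<Rightarrow> complex) \<Rightarrow> ('a \<times> (nat \<Rightarrow> complex)) \<times> ('a \<times> (nat \<Rightarrow> complex))" where
    "g = (\<lambda>u. ((fst u, \<lambda>i. if i < r (fst u) then snd u i else 0),
      (fst u, \<lambda>i. if i < s (fst u) then snd u (i + r (fst u)) else 0)))"
  have W: "tspace ?W = subtopology (prod_topology (tspace ?B) (tspace ?C)) {(e, f). fst e = fst f}"
    by (simp add: whitney_sum_def standard_bundle_simps)
  have topW: "t \<in> topspace (tspace ?W) \<longleftrightarrow> (\<exists>x z w. t = ((x, z), (x, w)) \<and> x \<in> topspace X \<and>
      (\<forall>i\<ge>r x. z i = 0) \<and> (\<forall>i\<ge>s x. w i = 0))" for t
    by (cases t) (auto simp: W topspace_standard_bundle)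
  have "continuous_map (tspace ?W) (tspace ?B) fst" "continuous_map (tspace ?W) (tspace ?C) snd"
    unfolding W by (auto intro: continuous_map_from_subtopology continuous_map_fst continuous_map_snd)
  then have c1: "continuous_map (tspace ?W) X (\<lambda>t. fst (fst t))"
      "continuous_map (tspace ?W) euclidean (\<lambda>t. snd (fst t) i)"
      "continuous_map (tspace ?W) euclidean (\<lambda>t. snd (snd t) i)" for i
    unfolding continuous_map_standard_bundle by auto
  have c2: "continuous_map (tspace ?D) X fst" "continuous_map (tspace ?D) euclidean (\<lambda>u. snd u i)" for i
    by (rule continuous_map_standard_bundle_coordinates)+
  have "continuous_map (tspace ?W) (tspace ?D) f"
    unfolding continuous_map_standard_bundle
  proof (intro conjI allI)
    show "continuous_map (tspace ?W) X (\<lambda>t. fst (f t))"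
      using c1(1) by (simp add: f_def)
    fix i
    have "continuous_map (tspace ?W) euclidean
        (\<lambda>t. (\<lambda>n t. if i < n then snd (fst t) i else snd (snd t) (i - n)) (r (fst (fst t))) t)"
    proof (rule continuous_map_discrete_family[where q = "\<lambda>t. r (fst (fst t))"
          and F = "\<lambda>n t. if i < n then snd (fst t) i else snd (snd t) (i - n)"])
      show "continuous_map (tspace ?W) (discrete_topology UNIV) (\<lambda>t. r (fst (fst t)))"
        using c1(1) r by (rule continuous_map_discrete_compose)
      show "continuous_map (subtopology (tspace ?W) S) euclidean
          (\<lambda>t. if i < n then snd (fst t) i else snd (snd t) (i - n))" for S n
        by (cases "i < n") (simp_all add: c1 continuous_map_from_subtopology)
    qed
    then show "continuous_map (tspace ?W) euclidean (\<lambda>t. snd (f t) i)"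
      by (simp add: f_def)
  next
    show "\<forall>t\<in>topspace (tspace ?W). \<forall>i\<ge>r (fst (f t)) + s (fst (f t)). snd (f t) i = 0"
      by (auto simp: topW f_def)
  qed
  moreover have "continuous_map (tspace ?D) (tspace ?W) g"
  proof -
    have B: "continuous_map (tspace ?D) (tspace ?B) (\<lambda>u. fst (g u))"
      unfolding continuous_map_standard_bundle
    proof (intro conjI allI)
      show "continuous_map (tspace ?D) X (\<lambda>u. fst (fst (g u)))"
        using c2(1) by (simp add: g_def)
      fix i
      have "continuous_map (tspace ?D) euclidean (\<lambda>u. (\<lambda>n u. if i < n then snd u i else 0) (r (fst u)) u)"
      proof (rule continuous_map_discrete_family[where q = "\<lambda>u. r (fst u)"
            and F = "\<lambda>n u. if i < n then snd u i else 0"])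
        show "continuous_map (tspace ?D) (discrete_topology UNIV) (\<lambda>u. r (fst u))"
          using c2(1) r by (rule continuous_map_discrete_compose)
        show "continuous_map (subtopology (tspace ?D) S) euclidean (\<lambda>u. if i < n then snd u i else 0)" for S n
          by (cases "i < n") (simp_all add: c2 continuous_map_from_subtopology)
      qed
      then show "continuous_map (tspace ?D) euclidean (\<lambda>u. snd (fst (g u)) i)"
        by (simp add: g_def)
    qed (auto simp: g_def)
    have C: "continuous_map (tspace ?D) (tspace ?C) (\<lambda>u. snd (g u))"
      unfolding continuous_map_standard_bundle
    proof (intro conjI allI)
      show "continuous_map (tspace ?D) X (\<lambda>u. fst (snd (g u)))"
        using c2(1) by (simp add: g_def)
      fix i
      have "continuous_map (tspace ?D) euclidean
          (\<lambda>u. (\<lambda>p u. if i < snd p then snd u (i + fst p) else 0) (r (fst u), s (fst u)) u)"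
      proof (rule continuous_map_discrete_family[where q = "\<lambda>u. (r (fst u), s (fst u))"
            and F = "\<lambda>p u. if i < snd p then snd u (i + fst p) else 0"])
        show "continuous_map (tspace ?D) (discrete_topology UNIV) (\<lambda>u. (r (fst u), s (fst u)))"
          by (rule continuous_map_discrete_comp2[OF continuous_map_discrete_compose[OF c2(1) r]
                continuous_map_discrete_compose[OF c2(1) s]])
        show "continuous_map (subtopology (tspace ?D) S) euclidean
            (\<lambda>u. if i < snd p then snd u (i + fst p) else 0)" for S p
          by (cases "i < snd p") (simp_all add: c2 continuous_map_from_subtopology)
      qed
      then show "continuous_map (tspace ?D) euclidean (\<lambda>u. snd (snd (g u)) i)"
        by (simp add: g_def cong: if_cong)
    qed (auto simp: g_def)
    have "continuous_map (tspace ?D) (prod_topology (tspace ?B) (tspace ?C)) g"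
      using B C by (simp add: continuous_map_pairwise o_def)
    then show ?thesis
      unfolding W by (rule continuous_map_into_subtopology) (auto simp: g_def)
  qed
  moreover have "g (f t) = t" if "t \<in> topspace (tspace ?W)" for t
    using that unfolding topW by (auto simp: f_def g_def fun_eq_iff)
  moreover have "f (g u) = u" if "u \<in> topspace (tspace ?D)" for u
    using that by (cases u) (auto simp: topspace_standard_bundle f_def g_def fun_eq_iff)
  ultimately have "homeomorphic_maps (tspace ?W) (tspace ?D) f g"
    unfolding homeomorphic_maps_def by blast
  then have "homeomorphic_map (tspace ?W) (tspace ?D) f"
    unfolding homeomorphic_map_maps by blast
  moreover have "bproj ?D (f t) = bproj ?W t" for t
    by (simp add: f_def standard_bundle_simps whitney_sum_def split_beta)
  moreover have "f (badd ?W t t') = badd ?D (f t) (f t')" "f (bscale ?W c t) = bscale ?D c (f t)"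
    if "t \<in> fibre ?W x" "t' \<in> fibre ?W x" for t t' x c
    using that
    by (cases t; cases t'; auto simp: fibre_whitney_sum fibre_standard_bundle,
        auto simp: whitney_sum_def standard_bundle_simps f_def fun_eq_iff)+
  ultimately have "bundle_iso ?W ?D f"
    unfolding bundle_iso_def by blast
  then show ?thesis
    unfolding bundle_isomorphic_def by blast
qed

lemma zero_bundle_standard_bundle:
  "bundle_isomorphic (zero_bundle X) (standard_bundle X (\<lambda>_. 0))" "fibrewise_closed (zero_bundle X)"
proof -
  let ?D = "standard_bundle X (\<lambda>_. 0)"
  have "continuous_map X (tspace ?D) (\<lambda>x. (x, \<lambda>_. 0))"
    by (simp add: continuous_map_standard_bundle)
  then have "homeomorphic_maps X (tspace ?D) (\<lambda>x. (x, \<lambda>_. 0)) fst"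
    unfolding homeomorphic_maps_def
    using continuous_map_standard_bundle_coordinates(1)[of X "\<lambda>_. 0"]
    by (auto simp: topspace_standard_bundle)
  then have "homeomorphic_map X (tspace ?D) (\<lambda>x. (x, \<lambda>_. 0))"
    unfolding homeomorphic_map_maps by blast
  then have "bundle_iso (zero_bundle X) ?D (\<lambda>x. (x, \<lambda>_. 0))"
    unfolding bundle_iso_def by (simp add: zero_bundle_def standard_bundle_simps)
  then show "bundle_isomorphic (zero_bundle X) ?D"
    unfolding bundle_isomorphic_def by blast
  show "fibrewise_closed (zero_bundle X)"
    by (auto simp: fibrewise_closed_def zero_bundle_def preim_def)
qed

section \<open>Classification of bundles by their rank\<close>

text \<open>Every open cover indexed by the points has a refinement that is a partition into open sets,
  phrased as a locally constant choice of a member of the cover.\<close>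

definition locally_constant_choices :: "'x topology \<Rightarrow> bool" where
  "locally_constant_choices X \<longleftrightarrow>
    (\<forall>W. (\<forall>x\<in>topspace X. openin X (W x) \<and> x \<in> W x) \<longrightarrow>
      (\<exists>\<sigma>. continuous_map X (discrete_topology UNIV) \<sigma> \<and>
        (\<forall>x\<in>topspace X. \<sigma> x \<in> topspace X \<and> x \<in> W (\<sigma> x))))"

text \<open>Let \<open>\<sigma>\<close> be a locally constant choice of a point whose trivialization is used. On the open
  set where \<open>\<sigma>\<close> takes the value \<open>p\<close>, the trivialization \<open>h p\<close> and its inverse \<open>k p\<close> are continuous;
  since these sets partition the space, the pieces fit together without any compatibility condition.\<close>

lemma vector_bundle_isomorphic_standard_bundle:
  assumes X: "locally_constant_choices X" and B: "vector_bundle X B"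
  obtains r where "r \<in> rank_functions X" "bundle_isomorphic B (standard_bundle X r)"
proof -
  have "\<forall>x\<in>topspace X. \<exists>U n h. x \<in> U \<and> local_trivialization X B U n h"
    using B by (simp add: vector_bundle_def)
  then have "\<exists>U n h. \<forall>x\<in>topspace X. x \<in> U x \<and> local_trivialization X B (U x) (n x) (h x)"
    by metis
  then obtain U n h where triv: "\<forall>x\<in>topspace X. x \<in> U x \<and> local_trivialization X B (U x) (n x) (h x)"
    by blast
  have "\<forall>x\<in>topspace X. openin X (U x) \<and> x \<in> U x"
    using triv by (simp add: local_trivialization_def)
  then obtain \<sigma> where \<sigma>: "continuous_map X (discrete_topology UNIV) \<sigma>"
    and \<sigma>U: "\<forall>x\<in>topspace X. \<sigma> x \<in> topspace X \<and> x \<in> U (\<sigma> x)"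
    using X unfolding locally_constant_choices_def by blast
  have "\<forall>p\<in>topspace X. \<exists>k. homeomorphic_maps (subtopology (tspace B) (preim B (U p)))
       (prod_topology (subtopology X (U p)) (complex_space (n p))) (h p) k"
    using triv by (simp add: local_trivialization_def homeomorphic_map_maps)
  from bchoice[OF this] obtain k where
    hk: "\<forall>p\<in>topspace X. homeomorphic_maps (subtopology (tspace B) (preim B (U p)))
       (prod_topology (subtopology X (U p)) (complex_space (n p))) (h p) (k p)" ..
  define r where "r = (\<lambda>y. if y \<in> topspace X then n (\<sigma> y) else 0)"
  have r: "r \<in> rank_functions X"
    using continuous_map_discrete_if[OF continuous_map_discrete_comp2[OF \<sigma> \<sigma>, of "\<lambda>p _. n p"], of 0]
    by (simp add: rank_functions_def r_def)
  let ?D = "standard_bundle X r"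
  have target: "prod_topology (subtopology X (U p)) (complex_space (n p)) =
      subtopology (sequence_product X) (U p \<times> {z. \<forall>i\<ge>n p. z i = 0})" for p
    by (simp add: complex_space_def subtopology_Times)
  have ch: "continuous_map (subtopology (tspace B) (preim B (U p)))
      (subtopology (sequence_product X) (U p \<times> {z. \<forall>i\<ge>n p. z i = 0})) (h p)"
    and ck: "continuous_map (subtopology (sequence_product X) (U p \<times> {z. \<forall>i\<ge>n p. z i = 0}))
      (subtopology (tspace B) (preim B (U p))) (k p)"
    and kh: "\<And>e. e \<in> preim B (U p) \<Longrightarrow> k p (h p e) = e"
    and hk': "\<And>y z. y \<in> U p \<Longrightarrow> \<forall>i\<ge>n p. z i = 0 \<Longrightarrow> h p (k p (y, z)) = (y, z)"
    and fst_h: "\<And>e. e \<in> preim B (U p) \<Longrightarrow> fst (h p e) = bproj B e"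
    and Usub: "U p \<subseteq> topspace X"
    if p: "p \<in> topspace X" for p
  proof -
    have hkp: "homeomorphic_maps (subtopology (tspace B) (preim B (U p)))
       (subtopology (sequence_product X) (U p \<times> {z. \<forall>i\<ge>n p. z i = 0})) (h p) (k p)"
      using hk p unfolding target by blast
    then show "continuous_map (subtopology (tspace B) (preim B (U p)))
      (subtopology (sequence_product X) (U p \<times> {z. \<forall>i\<ge>n p. z i = 0})) (h p)"
      "continuous_map (subtopology (sequence_product X) (U p \<times> {z. \<forall>i\<ge>n p. z i = 0}))
      (subtopology (tspace B) (preim B (U p))) (k p)"
      unfolding homeomorphic_maps_def by blast+
    show Up: "U p \<subseteq> topspace X"
    proof (rule openin_subset)
      show "openin X (U p)"
        using triv p by (simp add: local_trivialization_def)
    qed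
    show "k p (h p e) = e" if "e \<in> preim B (U p)" for e
    proof -
      have "e \<in> topspace (subtopology (tspace B) (preim B (U p)))"
        using that by (simp add: preim_def)
      then show ?thesis
        using hkp unfolding homeomorphic_maps_def by blast
    qed
    show "h p (k p (y, z)) = (y, z)" if "y \<in> U p" "\<forall>i\<ge>n p. z i = 0" for y z
    proof -
      have "(y, z) \<in> topspace (subtopology (sequence_product X) (U p \<times> {z. \<forall>i\<ge>n p. z i = 0}))"
        using that Up by auto
      then show ?thesis
        using hkp unfolding homeomorphic_maps_def by blast
    qed
    show "fst (h p e) = bproj B e" if "e \<in> preim B (U p)" for e
      using triv p that by (simp add: local_trivialization_def)
  qed
  have preimU: "e \<in> preim B (U (\<sigma> (bproj B e)))" "\<sigma> (bproj B e) \<in> topspace X" "bproj B e \<in> topspace X"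
    if "e \<in> topspace (tspace B)" for e
    using that \<sigma>U bproj_in_topspace[OF B that] by (auto simp: preim_def)
  define f where "f = (\<lambda>e. h (\<sigma> (bproj B e)) e)"
  define g where "g = (\<lambda>u. k (\<sigma> (fst u)) u)"
  have fst_f: "fst (f e) = bproj B e" if "e \<in> topspace (tspace B)" for e
    unfolding f_def by (rule fst_h[OF preimU(2)[OF that] preimU(1)[OF that]])
  have hW: "continuous_map (subtopology (tspace B) {e \<in> topspace (tspace B). \<sigma> (bproj B e) = p}) (tspace ?D) (h p)"
    if p: "p \<in> topspace X" for p
  proof -
    let ?W = "{e \<in> topspace (tspace B). \<sigma> (bproj B e) = p}"
    have sub: "?W \<subseteq> preim B (U p)"
      using preimU(1) by auto
    have c: "continuous_map (subtopology (tspace B) ?W)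
        (subtopology (sequence_product X) (U p \<times> {z. \<forall>i\<ge>n p. z i = 0})) (h p)"
      using ch[OF p] sub by (rule continuous_map_from_subtopology_mono)
    have "\<forall>i\<ge>r (fst (h p e)). snd (h p e) i = 0" if e: "e \<in> ?W" for e
    proof -
      have "fst (h p e) = bproj B e"
        using e sub by (intro fst_h[OF p] subsetD[OF sub])
      then have "r (fst (h p e)) = n p"
        using e preimU(3)[of e] by (simp add: r_def)
      moreover have "e \<in> topspace (subtopology (tspace B) ?W)"
        using e by simp
      then have "h p e \<in> topspace (subtopology (sequence_product X) (U p \<times> {z. \<forall>i\<ge>n p. z i = 0}))"
        using continuous_map_image_subset_topspace[OF c] by blast
      then have "\<forall>i\<ge>n p. snd (h p e) i = 0"
        by auto
      ultimately show ?thesis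
        by simp
    qed
    moreover have "continuous_map (subtopology (tspace B) ?W) (sequence_product X) (h p)"
      using c by (rule continuous_map_into_fulltopology)
    ultimately show ?thesis
      unfolding continuous_map_standard_bundle continuous_map_sequence_product by simp
  qed
  have kW: "continuous_map (subtopology (tspace ?D) {u \<in> topspace (tspace ?D). \<sigma> (fst u) = p}) (tspace B) (k p)"
    if p: "p \<in> topspace X" for p
  proof -
    let ?W = "{u \<in> topspace (tspace ?D). \<sigma> (fst u) = p}"
    have sub: "?W \<subseteq> U p \<times> {z. \<forall>i\<ge>n p. z i = 0}"
      using \<sigma>U by (auto simp: topspace_standard_bundle r_def)
    have "{(x, z). \<forall>i\<ge>r x. z i = 0} \<inter> ?W = ?W"
      by (auto simp: topspace_standard_bundle)
    then have eq: "subtopology (tspace ?D) ?W = subtopology (sequence_product X) ?W"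
      by (simp only: standard_bundle_simps(1) subtopology_subtopology)
    have "continuous_map (subtopology (tspace ?D) ?W) (subtopology (tspace B) (preim B (U p))) (k p)"
      unfolding eq using ck[OF p] sub by (rule continuous_map_from_subtopology_mono)
    then show ?thesis
      by (rule continuous_map_into_fulltopology)
  qed
  have "continuous_map (tspace B) (tspace ?D) f"
    unfolding f_def
  proof (rule continuous_map_discrete_family[where q = "\<lambda>e. \<sigma> (bproj B e)" and F = h])
    have "continuous_map (tspace B) X (bproj B)"
      using B by (simp add: vector_bundle_def)
    then show "continuous_map (tspace B) (discrete_topology UNIV) (\<lambda>e. \<sigma> (bproj B e))"
      using \<sigma> by (rule continuous_map_discrete_compose)
  qed (rule hW, rule preimU(2))
  moreover have "continuous_map (tspace ?D) (tspace B) g"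
    unfolding g_def
  proof (rule continuous_map_discrete_family[where q = "\<lambda>u. \<sigma> (fst u)" and F = k])
    show "continuous_map (tspace ?D) (discrete_topology UNIV) (\<lambda>u. \<sigma> (fst u))"
      using continuous_map_standard_bundle_coordinates(1) \<sigma> by (rule continuous_map_discrete_compose)
    fix u assume "u \<in> topspace (tspace ?D)"
    then have "fst u \<in> topspace X"
      by (auto simp: topspace_standard_bundle)
    then have "\<sigma> (fst u) \<in> topspace X"
      using \<sigma>U by blast
    then show "continuous_map (subtopology (tspace ?D) {s \<in> topspace (tspace ?D). \<sigma> (fst s) = \<sigma> (fst u)})
        (tspace B) (k (\<sigma> (fst u)))"
      by (rule kW)
  qed
  moreover have "g (f e) = e" if e: "e \<in> topspace (tspace B)" for e
    using fst_f[OF e] kh[OF preimU(2)[OF e] preimU(1)[OF e]] by (simp add: g_def) (simp add: f_def)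
  moreover have "f (g u) = u" if u: "u \<in> topspace (tspace ?D)" for u
  proof -
    obtain y z where yz: "u = (y, z)" "y \<in> topspace X" "\<forall>i\<ge>n (\<sigma> y). z i = 0"
      using u by (auto simp: topspace_standard_bundle r_def)
    let ?p = "\<sigma> y"
    have p: "?p \<in> topspace X" "y \<in> U ?p"
      using \<sigma>U yz(2) by auto
    have "(y, z) \<in> topspace (subtopology (sequence_product X) (U ?p \<times> {z. \<forall>i\<ge>n ?p. z i = 0}))"
      using p(2) yz by auto
    then have mem: "k ?p (y, z) \<in> preim B (U ?p)"
      using continuous_map_image_subset_topspace[OF ck[OF p(1)]] by auto
    have h: "h ?p (k ?p (y, z)) = (y, z)"
      using p(2) yz(3) by (rule hk'[OF p(1)])
    then have "bproj B (k ?p (y, z)) = y"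
      using fst_h[OF p(1) mem] by simp
    with h yz(1) show ?thesis
      by (simp add: f_def g_def)
  qed
  ultimately have "homeomorphic_maps (tspace B) (tspace ?D) f g"
    unfolding homeomorphic_maps_def by blast
  then have hom: "homeomorphic_map (tspace B) (tspace ?D) f"
    unfolding homeomorphic_map_maps by blast
  have fib: "bproj B e = x" "e \<in> topspace (tspace B)" "\<sigma> x \<in> topspace X" "x \<in> U (\<sigma> x)"
    if "e \<in> fibre B x" for e x
    using that preimU[of e] by (auto simp: preim_def)
  have pair: "f e = (x, snd (f e))" if "e \<in> fibre B x" for e x
    using fst_f[OF fib(2)[OF that]] fib(1)[OF that] by (simp add: prod_eq_iff)
  have closed: "fibrewise_closed B"
    using B by (rule vector_bundle_fibrewise_closed)
  have "f (badd B e e') = badd ?D (f e) (f e')" if e: "e \<in> fibre B x" and e': "e' \<in> fibre B x" for x e e'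
  proof -
    have s: "badd B e e' \<in> fibre B x"
      using closed e e' by (rule fibrewise_closedD)
    obtain a a' where a: "f e = (x, a)" "f e' = (x, a')"
      using pair[OF e] pair[OF e'] by blast
    have "snd (f (badd B e e')) = (\<lambda>i. snd (f e) i + snd (f e') i)"
      using triv fib[OF e] fib[OF e'] fib[OF s] e e' by (simp add: f_def local_trivialization_def)
    then have "f (badd B e e') = (x, \<lambda>i. a i + a' i)"
      using pair[OF s] by (simp add: a)
    then show ?thesis
      by (simp add: a standard_bundle_simps)
  qed
  moreover have "f (bscale B c e) = bscale ?D c (f e)" if e: "e \<in> fibre B x" for x c e
  proof -
    have s: "bscale B c e \<in> fibre B x"
      using closed e by (rule fibrewise_closedD)
    obtain a where a: "f e = (x, a)"
      using pair[OF e] by blast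
    have "snd (f (bscale B c e)) = (\<lambda>i. c * snd (f e) i)"
      using triv fib[OF e] fib[OF s] e by (simp add: f_def local_trivialization_def)
    then have "f (bscale B c e) = (x, \<lambda>i. c * a i)"
      using pair[OF s] by (simp add: a)
    then show ?thesis
      by (simp add: a standard_bundle_simps)
  qed
  moreover have "bproj ?D (f e) = bproj B e" if "e \<in> topspace (tspace B)" for e
    using fst_f[OF that] by (simp add: standard_bundle_simps(2))
  ultimately have "bundle_iso B ?D f"
    using hom unfolding bundle_iso_def by blast
  then show thesis
    using that[OF r] unfolding bundle_isomorphic_def by blast
qed

lemma K0_group_locally_constant_choices:
  fixes X :: "'x topology"
  assumes X: "locally_constant_choices X"
  shows "comm_group (K0_group X)" "continuous_int_group X \<cong> K0_group X"
proof -
  let ?cls = "\<lambda>r. bundle_class X (standard_bundle X r)" and ?N = "rank_functions X"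
  have cont: "continuous_map X (discrete_topology UNIV) r" if "r \<in> ?N" for r
    using that by (simp add: rank_functions_def)
  have vb: "vector_bundle X (standard_bundle X r)" if "r \<in> ?N" for r
    using cont[OF that] by (rule vector_bundle_standard_bundle)
  have mem: "standard_bundle X r \<in> ?cls r" if "r \<in> ?N" for r
    using vb[OF that] bundle_isomorphic_refl by (simp add: bundle_class_def)
  have carr: "carrier (bundle_monoid X) = ?cls ` ?N"
  proof (intro equalityI subsetI)
    fix P assume "P \<in> carrier (bundle_monoid X)"
    then obtain B :: "'x ubundle" where B: "vector_bundle X B" "P = bundle_class X B"
      by (auto simp: bundle_monoid_def)
    obtain r where r: "r \<in> ?N" "bundle_isomorphic B (standard_bundle X r)"
      using X B(1) by (rule vector_bundle_isomorphic_standard_bundle)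
    have "P = ?cls r"
      unfolding B(2) using vector_bundle_fibrewise_closed[OF B(1)] r(2) by (rule bundle_class_eq)
    with r(1) show "P \<in> ?cls ` ?N"
      by blast
  next
    fix P assume "P \<in> ?cls ` ?N"
    then show "P \<in> carrier (bundle_monoid X)"
      using vb by (auto simp: bundle_monoid_def)
  qed
  have inj: "inj_on ?cls ?N"
  proof (rule inj_onI)
    fix r s assume r: "r \<in> ?N" and s: "s \<in> ?N" and eq: "?cls r = ?cls s"
    have "standard_bundle X s \<in> ?cls r" "standard_bundle X r \<in> ?cls s"
      using mem[OF r] mem[OF s] eq by auto
    then have iso: "bundle_isomorphic (standard_bundle X r) (standard_bundle X s)"
      "bundle_isomorphic (standard_bundle X s) (standard_bundle X r)"
      by (simp_all add: bundle_class_def)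
    show "r = s"
    proof
      show "r x = s x" for x
      proof (cases "x \<in> topspace X")
        case True
        then show ?thesis
          using standard_bundle_isomorphic_le[OF iso(1)] standard_bundle_isomorphic_le[OF iso(2)]
          by (intro order.antisym)
      next
        case False
        then show ?thesis
          using r s by (simp add: rank_functions_def)
      qed
    qed
  qed
  have mult: "?cls r \<otimes>\<^bsub>bundle_monoid X\<^esub> ?cls s = ?cls (\<lambda>x. r x + s x)" if r: "r \<in> ?N" and s: "s \<in> ?N" for r s
  proof -
    let ?R = "standard_bundle X r" and ?S = "standard_bundle X s"
    have closed: "fibrewise_closed (whitney_sum ?R ?S)"
      using vb[OF r] vb[OF s] by (intro fibrewise_closed_whitney_sum vector_bundle_fibrewise_closed)
    have const: "bundle_class X (whitney_sum B C) = ?cls (\<lambda>x. r x + s x)" if "B \<in> ?cls r" "C \<in> ?cls s" for B C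
    proof -
      have "bundle_isomorphic (whitney_sum ?R ?S) (whitney_sum B C)"
        using that by (intro whitney_sum_isomorphic) (simp_all add: bundle_class_def)
      then have "bundle_class X (whitney_sum B C) = bundle_class X (whitney_sum ?R ?S)"
        using bundle_class_eq[OF closed] by metis
      also have "\<dots> = ?cls (\<lambda>x. r x + s x)"
        using bundle_class_eq[OF closed] whitney_sum_standard_bundle[OF cont[OF r] cont[OF s]] by metis
      finally show ?thesis .
    qed
    have "(\<Union>B\<in>?cls r. \<Union>C\<in>?cls s. bundle_class X (whitney_sum B C)) =
        (\<Union>B\<in>?cls r. \<Union>C\<in>?cls s. ?cls (\<lambda>x. r x + s x))"
      by (intro SUP_cong refl const)
    also have "\<dots> = ?cls (\<lambda>x. r x + s x)"
      using mem[OF r] mem[OF s] by auto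
    finally show ?thesis
      by (simp add: bundle_monoid_def)
  qed
  have one: "\<one>\<^bsub>bundle_monoid X\<^esub> = ?cls (\<lambda>_. 0)"
    using bundle_class_eq[OF zero_bundle_standard_bundle(2) zero_bundle_standard_bundle(1)]
    by (simp add: bundle_monoid_def)
  show "comm_group (K0_group X)" "continuous_int_group X \<cong> K0_group X"
    unfolding K0_group_def using grothendieck_group_rank_functions[OF carr inj mult one] by blast+
qed

section \<open>The two isomorphisms\<close>

lemma locally_constant_choices_stone_space: "locally_constant_choices stone_space"
  unfolding locally_constant_choices_def
proof (intro allI impI)
  fix W :: "'a set \<Rightarrow> 'a set set"
  assume "\<forall>U\<in>topspace stone_space. openin stone_space (W U) \<and> U \<in> W U"
  then have W: "openin stone_space (W U) \<and> U \<in> W U" if "U \<in> ultrafilters" for U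
    using that by simp
  obtain \<sigma> where "continuous_map stone_space (discrete_topology UNIV) \<sigma>"
    and "finite (\<sigma> ` ultrafilters)"
    and "\<forall>U\<in>ultrafilters. \<sigma> U \<in> ultrafilters \<and> U \<in> W (\<sigma> U)"
    by (rule stone_space_locally_constant_choice[of W, OF W])
  then show "\<exists>\<sigma>. continuous_map stone_space (discrete_topology UNIV) \<sigma> \<and>
      (\<forall>U\<in>topspace stone_space. \<sigma> U \<in> topspace stone_space \<and> U \<in> W (\<sigma> U))"
    by (intro exI[of _ \<sigma>]) simp
qed

theorem mainTheorem11:
  shows "comm_group (K_group (boolean_semigroup :: 'a::boolean_algebra semigrp)) \<and>
    comm_group (continuous_int_group (stone_space :: 'a set topology)) \<and>
    comm_group (K0_group (stone_space :: 'a set topology)) \<and>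
    K_group (boolean_semigroup :: 'a semigrp) \<cong> continuous_int_group (stone_space :: 'a set topology) \<and>
    K_group (boolean_semigroup :: 'a semigrp) \<cong> K0_group (stone_space :: 'a set topology)"
proof (intro conjI)
  let ?K = "K_group (boolean_semigroup :: 'a semigrp)"
  let ?Z = "continuous_int_group (stone_space :: 'a set topology)"
  show "comm_group ?K" and "comm_group (K0_group (stone_space :: 'a set topology))"
    and Z: "comm_group ?Z"
    by (rule K_group_boolean_semigroup K0_group_locally_constant_choices
        locally_constant_choices_stone_space comm_group_continuous_int_group)+
  have ZK: "?Z \<cong> ?K"
    by (rule K_group_boolean_semigroup)
  have ZK0: "?Z \<cong> K0_group (stone_space :: 'a set topology)"
    by (rule K0_group_locally_constant_choices locally_constant_choices_stone_space)+
  interpret Z: comm_group ?Z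
    by (rule Z)
  show "?K \<cong> ?Z"
    using ZK by (rule Z.iso_sym)
  then show "?K \<cong> K0_group (stone_space :: 'a set topology)"
    using ZK0 by (rule iso_trans)
qed

end
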